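(* Every weighted $C^*$-algebra has an order unitization. That is, if $(A,\pi)$ is a weighted $C^*$-algebra, then there exist an order unit $C^*$-Segal algebra $B$ (with some order unit $w$) and a positive isometric homomorphism $\phi:A\to B$ such that $\phi(A)$ is a faithful ideal of $B$.
   Context: Algebras are complex; ideals are two-sided. A Banach algebra $A$ with norm $\|\cdot\|$ is a $C^*$-Segal algebra (in the $C^*$-algebra $C$) if there is a continuous injective homomorphism $\iota:A\to C$ whose image is a dense ideal of $C$; $A$ is identified with $\iota(A)\subseteq C$. It is self-adjoint if $\iota(A)$ is closed under the involution of $C$. Standing convention: for self-adjoint $A$, the norm is assumed to satisfy $\|a^*\|=\|a\|$ for all $a\in A$. $A_+:=A\cap C_+$, $A_h$ is the set of self-adjoint elements of $A$, and $x\le y$ in $A_h$ means $y-x\in A_+$. A weighted $C^*$-algebra is a pair $(A,\pi)$ where $A$ is a self-adjoint $C^*$-Segal algebra in a $C^*$-algebra $C$ and $\pi:A\to M(C)$ is a positive (i.e. $\pi(A_+)\subseteq M(C)_+$) isometric $C$-bimodule homomorphism, $M(C)$ being the multiplier algebra of $C$. An order unit $C^*$-Segal algebra is a pair $(B,w)$ where $B$ is a self-adjoint $C^*$-Segal algebra and $w\in B_+$ is an order unit (each $x\in B_h$ satisfies $x\le lw$ for some $l>0$) such that $\|b\|=\inf\{l>0:\ -lw\le b\le lw\}$ for all $b\in B_h$. An order unitization of a self-adjoint $C^*$-Segal algebra $A$ is a pair $(B,\phi)$ such that $B$ is an order unit $C^*$-Segal algebra, $\phi:A\to B$ is a positive ($\phi(A_+)\subseteq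 B_+$) isometric homomorphism, and $\phi(A)$ is a faithful ideal of $B$. An ideal $I$ of an algebra $B$ is faithful if for each $b\in B\setminus\{0\}$ there are $m,n\in I$ with $bm\ne0$ and $nb\ne0$. *)

theory Defs
  imports "HOL-Analysis.Analysis"
begin

section \<open>C*-algebras\<close>

class scaleC =
  fixes scaleC :: "complex \<Rightarrow> 'a \<Rightarrow> 'a" (infixr "*\<^sub>C" 75)

class star =
  fixes star :: "'a \<Rightarrow> 'a"

text \<open>No unit is required, and the zero algebra is allowed.\<close>

class cstar_algebra = real_normed_algebra + banach + scaleC + star +
  assumes scaleC_add_right: "a *\<^sub>C (x + y) = a *\<^sub>C x + a *\<^sub>C y"
    and scaleC_add_left: "(a + b) *\<^sub>C x = a *\<^sub>C x + b *\<^sub>C x"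
    and scaleC_scaleC: "a *\<^sub>C b *\<^sub>C x = (a * b) *\<^sub>C x"
    and scaleR_scaleC: "r *\<^sub>R x = complex_of_real r *\<^sub>C x"
    and mult_scaleC_left: "(a *\<^sub>C x) * y = a *\<^sub>C (x * y)"
    and mult_scaleC_right: "x * (a *\<^sub>C y) = a *\<^sub>C (x * y)"
    and norm_scaleC: "norm (a *\<^sub>C x) = cmod a * norm x"
    and star_add: "star (x + y) = star x + star y"
    and star_scaleC: "star (a *\<^sub>C x) = cnj a *\<^sub>C star x"
    and star_mult: "star (x * y) = star y * star x"
    and star_star [simp]: "star (star x) = x"
    and cstar_identity: "norm (star x * x) = (norm x)\<^sup>2"

lemma scaleC_one [simp]: "1 *\<^sub>C x = x" for x :: "'a::cstar_algebra"
  using scaleR_scaleC[of 1 x] by simp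

lemma scaleC_zero_right [simp]: "a *\<^sub>C (0 :: 'a::cstar_algebra) = 0"
  using scaleC_add_right[of a 0 0] by simp

lemma scaleC_minus_right: "a *\<^sub>C (- x) = - (a *\<^sub>C x)" for x :: "'a::cstar_algebra"
  using scaleC_add_right[of a x "- x"] by (simp add: eq_neg_iff_add_eq_0 add.commute)

lemma star_zero [simp]: "star (0 :: 'a::cstar_algebra) = 0"
  using star_add[of 0 0] by simp

lemma star_minus: "star (- x) = - star x" for x :: "'a::cstar_algebra"
  using star_add[of x "- x"] by (simp add: eq_neg_iff_add_eq_0 add.commute)

lemma star_scaleR: "star (r *\<^sub>R x) = r *\<^sub>R star x" for x :: "'a::cstar_algebra"
  by (simp add: scaleR_scaleC star_scaleC)

lemma norm_star [simp]: "norm (star x) = norm x" for x :: "'a::cstar_algebra"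
proof -
  have le: "norm y \<le> norm (star y)" for y :: 'a
  proof (cases "norm y = 0")
    case False
    have "norm y * norm y \<le> norm (star y) * norm y"
      using cstar_identity[of y] norm_mult_ineq[of "star y" y] by (simp add: power2_eq_square)
    then show ?thesis using False by (simp add: mult_le_cancel_right)
  qed simp
  show ?thesis using le[of x] le[of "star x"] by simp
qed

lemma cstar_identity': "norm (x * star x) = (norm x)\<^sup>2" for x :: "'a::cstar_algebra"
  using cstar_identity[of "star x"] by simp

lemma bounded_linear_star: "bounded_linear (star :: 'a::cstar_algebra \<Rightarrow> 'a)"
  by (rule bounded_linear_intro[where K = 1]) (auto simp: star_add star_scaleR)

lemma bounded_linear_scaleC_right: "bounded_linear ((*\<^sub>C) c :: 'a::cstar_algebra \<Rightarrow> 'a)"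
  by (rule bounded_linear_intro[where K = "cmod c"])
    (auto simp: scaleC_add_right norm_scaleC scaleR_scaleC scaleC_scaleC mult.commute)

section \<open>The multiplier algebra\<close>

text \<open>
  Double centralizers of \<open>'a\<close>: pairs \<open>(L, R)\<close> of bounded complex-linear maps with
  \<open>L (x y) = L x y\<close>, \<open>R (x y) = x R y\<close> and \<open>R x y = x L y\<close>.  The type \<open>'a \<Rightarrow>\<^sub>L 'a\<close>
  only provides boundedness and real-linearity.
\<close>

typedef (overloaded) 'a multiplier =
  "{(L :: 'a::cstar_algebra \<Rightarrow>\<^sub>L 'a, R :: 'a \<Rightarrow>\<^sub>L 'a).
     (\<forall>c x. L (c *\<^sub>C x) = c *\<^sub>C L x) \<and> (\<forall>c x. R (c *\<^sub>C x) = c *\<^sub>C R x) \<and>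
     (\<forall>x y. L (x * y) = L x * y) \<and> (\<forall>x y. R (x * y) = x * R y) \<and>
     (\<forall>x y. R x * y = x * L y)}"
  by (rule exI[of _ "(0, 0)"]) auto

definition lmul :: "'a::cstar_algebra multiplier \<Rightarrow> 'a \<Rightarrow>\<^sub>L 'a"
  where "lmul m = fst (Rep_multiplier m)"

definition rmul :: "'a::cstar_algebra multiplier \<Rightarrow> 'a \<Rightarrow>\<^sub>L 'a"
  where "rmul m = snd (Rep_multiplier m)"

text \<open>Meaningful only if the pair is a double centralizer.\<close>

definition mk_multiplier :: "('a::cstar_algebra \<Rightarrow> 'a) \<Rightarrow> ('a \<Rightarrow> 'a) \<Rightarrow> 'a multiplier"
  where "mk_multiplier l r = Abs_multiplier (Blinfun l, Blinfun r)"

lemma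
  shows lmul_scaleC: "lmul m (c *\<^sub>C x) = c *\<^sub>C lmul m x"
    and rmul_scaleC: "rmul m (c *\<^sub>C x) = c *\<^sub>C rmul m x"
    and lmul_mult: "lmul m (x * y) = lmul m x * y"
    and rmul_mult: "rmul m (x * y) = x * rmul m y"
    and rmul_lmul: "rmul m x * y = x * lmul m y"
  using Rep_multiplier[of m] by (auto simp: lmul_def rmul_def split: prod.splits)

lemma multiplier_eqI:
  assumes "\<And>x. lmul m x = lmul n x" and "\<And>x. rmul m x = rmul n x"
  shows "m = n"
  using assms by (metis Rep_multiplier_inject blinfun_eqI lmul_def prod.expand rmul_def)

lemma mk_multiplier:
  assumes l: "bounded_linear l" and r: "bounded_linear r"
    and "\<And>c x. l (c *\<^sub>C x) = c *\<^sub>C l x" and "\<And>c x. r (c *\<^sub>C x) = c *\<^sub>C r x"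
    and "\<And>x y. l (x * y) = l x * y" and "\<And>x y. r (x * y) = x * r y"
    and "\<And>x y. r x * y = x * l y"
  shows "lmul (mk_multiplier l r) = Blinfun l" and "rmul (mk_multiplier l r) = Blinfun r"
    and "lmul (mk_multiplier l r) x = l x" and "rmul (mk_multiplier l r) x = r x"
proof -
  have "Rep_multiplier (mk_multiplier l r) = (Blinfun l, Blinfun r)"
    unfolding mk_multiplier_def
    by (rule Abs_multiplier_inverse)
      (use assms in \<open>simp add: bounded_linear_Blinfun_apply[OF l] bounded_linear_Blinfun_apply[OF r]\<close>)
  then show "lmul (mk_multiplier l r) = Blinfun l" "rmul (mk_multiplier l r) = Blinfun r"
    by (simp_all add: lmul_def rmul_def)
  then show "lmul (mk_multiplier l r) x = l x" "rmul (mk_multiplier l r) x = r x"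
    using l r by (simp_all add: bounded_linear_Blinfun_apply)
qed

lemma norm_rmul: "norm (rmul m) = norm (lmul m)"
proof (rule antisym)
  show "norm (rmul m) \<le> norm (lmul m)"
  proof (rule norm_blinfun_bound)
    fix x
    let ?z = "rmul m x"
    have "norm ?z * norm ?z = norm (?z * star ?z)"
      by (simp add: cstar_identity' power2_eq_square)
    also have "\<dots> = norm (x * lmul m (star ?z))" by (simp add: rmul_lmul)
    also have "\<dots> \<le> norm x * norm (lmul m (star ?z))" by (rule norm_mult_ineq)
    also have "\<dots> \<le> norm x * (norm (lmul m) * norm (star ?z))"
      by (intro mult_left_mono norm_blinfun) simp
    finally have "norm ?z * norm ?z \<le> (norm (lmul m) * norm x) * norm ?z"
      by (simp add: algebra_simps)
    then show "norm ?z \<le> norm (lmul m) * norm x"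
      by (cases "norm ?z = 0") (auto simp: mult_le_cancel_right)
  qed simp
next
  show "norm (lmul m) \<le> norm (rmul m)"
  proof (rule norm_blinfun_bound)
    fix x
    let ?z = "lmul m x"
    have "norm ?z * norm ?z = norm (star ?z * ?z)"
      by (simp add: cstar_identity power2_eq_square)
    also have "\<dots> = norm (rmul m (star ?z) * x)" by (simp add: rmul_lmul)
    also have "\<dots> \<le> norm (rmul m (star ?z)) * norm x" by (rule norm_mult_ineq)
    also have "\<dots> \<le> (norm (rmul m) * norm (star ?z)) * norm x"
      by (intro mult_right_mono norm_blinfun) simp
    finally have "norm ?z * norm ?z \<le> (norm (rmul m) * norm x) * norm ?z"
      by (simp add: algebra_simps)
    then show "norm ?z \<le> norm (rmul m) * norm x"
      by (cases "norm ?z = 0") (auto simp: mult_le_cancel_right)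
  qed simp
qed

instantiation multiplier :: (cstar_algebra) "{real_normed_algebra, scaleC, star}"
begin

definition "0 = mk_multiplier (\<lambda>x. 0) (\<lambda>x. 0)"
definition "m + n = mk_multiplier (\<lambda>x. lmul m x + lmul n x) (\<lambda>x. rmul m x + rmul n x)"
definition "- m = mk_multiplier (\<lambda>x. - lmul m x) (\<lambda>x. - rmul m x)"
definition "m - n = mk_multiplier (\<lambda>x. lmul m x - lmul n x) (\<lambda>x. rmul m x - rmul n x)"
definition "m * n = mk_multiplier (\<lambda>x. lmul m (lmul n x)) (\<lambda>x. rmul n (rmul m x))"
definition "c *\<^sub>C m = mk_multiplier (\<lambda>x. c *\<^sub>C lmul m x) (\<lambda>x. c *\<^sub>C rmul m x)"
definition "r *\<^sub>R m = mk_multiplier (\<lambda>x. r *\<^sub>R lmul m x) (\<lambda>x. r *\<^sub>R rmul m x)"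
definition "star m = mk_multiplier (\<lambda>x. star (rmul m (star x))) (\<lambda>x. star (lmul m (star x)))"
definition "norm m = norm (lmul m)"
definition "dist m n = norm (m - n)" for m n :: "'a multiplier"
definition "sgn m = inverse (norm m) *\<^sub>R m" for m :: "'a multiplier"
definition [code del]: "uniformity = (INF e\<in>{0<..}. principal {(m, n :: 'a multiplier). dist m n < e})"
definition [code del]: "open U = (\<forall>m\<in>U. \<forall>\<^sub>F (m', n) in uniformity. m' = m \<longrightarrow> n \<in> U)"
  for U :: "'a multiplier set"

lemma scaleR_scaleC_commute: "r *\<^sub>R c *\<^sub>C x = c *\<^sub>C r *\<^sub>R (x :: 'b::cstar_algebra)"
  by (simp add: scaleR_scaleC scaleC_scaleC mult.commute)

lemma scaleC_diff_right: "c *\<^sub>C (x - y) = c *\<^sub>C x - c *\<^sub>C (y :: 'b::cstar_algebra)"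
  using scaleC_add_right[of c x "- y"] by (simp add: scaleC_minus_right)

lemmas mul_rules = lmul_scaleC rmul_scaleC lmul_mult rmul_mult rmul_lmul

lemma
  shows lmul_zero: "lmul 0 x = 0" and rmul_zero: "rmul 0 x = 0"
  unfolding zero_multiplier_def by (subst mk_multiplier; simp)+

lemma
  shows lmul_plus: "lmul (m + n) x = lmul m x + lmul n x"
    and rmul_plus: "rmul (m + n) x = rmul m x + rmul n x"
  unfolding plus_multiplier_def
  by (subst mk_multiplier; auto intro!: bounded_linear_intros simp: mul_rules scaleC_add_right algebra_simps)+

lemma
  shows lmul_minus: "lmul (- m) x = - lmul m x" and rmul_minus: "rmul (- m) x = - rmul m x"
  unfolding uminus_multiplier_def
  by (subst mk_multiplier; auto intro!: bounded_linear_minus blinfun.bounded_linear_right simp: mul_rules scaleC_minus_right algebra_simps)+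

lemma
  shows lmul_diff: "lmul (m - n) x = lmul m x - lmul n x"
    and rmul_diff: "rmul (m - n) x = rmul m x - rmul n x"
  unfolding minus_multiplier_def
  by (subst mk_multiplier; auto intro!: bounded_linear_intros simp: mul_rules scaleC_diff_right algebra_simps)+

lemma
  shows lmul_times: "lmul (m * n) x = lmul m (lmul n x)"
    and rmul_times: "rmul (m * n) x = rmul n (rmul m x)"
  unfolding times_multiplier_def
  by (subst mk_multiplier; auto intro!: bounded_linear_intros simp: mul_rules)+

lemma
  shows lmul_scaleR: "lmul (r *\<^sub>R m) x = r *\<^sub>R lmul m x"
    and rmul_scaleR: "rmul (r *\<^sub>R m) x = r *\<^sub>R rmul m x"
  unfolding scaleR_multiplier_def
  by (subst mk_multiplier; auto intro!: bounded_linear_intros simp: mul_rules scaleR_scaleC_commute)+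

lemma bounded_linear_scaleC_lmul: "bounded_linear (\<lambda>x. c *\<^sub>C blinfun_apply f (x :: 'b::cstar_algebra) :: 'b)"
  by (rule bounded_linear_compose[OF bounded_linear_scaleC_right]) (rule blinfun.bounded_linear_right)

lemma bounded_linear_star_conj: "bounded_linear (\<lambda>x. star (blinfun_apply f (star (x :: 'b::cstar_algebra))) :: 'b)"
  by (intro bounded_linear_compose[OF bounded_linear_star]
      bounded_linear_compose[OF blinfun.bounded_linear_right] bounded_linear_star)

lemma
  shows lmul_scaleC': "lmul (c *\<^sub>C m) x = c *\<^sub>C lmul m x"
    and rmul_scaleC': "rmul (c *\<^sub>C m) x = c *\<^sub>C rmul m x"
  unfolding scaleC_multiplier_def
  by (subst mk_multiplier; auto intro!: bounded_linear_scaleC_lmul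
      simp: mul_rules scaleC_scaleC mult.commute mult_scaleC_left mult_scaleC_right)+

lemma star_rmul_lmul: "star (lmul m (star x)) * y = x * star (rmul m (star y))"
proof -
  have "star (lmul m (star x)) * y = star (star y * lmul m (star x))" by (simp add: star_mult)
  also have "\<dots> = star (rmul m (star y) * star x)" by (simp add: rmul_lmul)
  also have "\<dots> = x * star (rmul m (star y))" by (simp add: star_mult)
  finally show ?thesis .
qed

lemma
  shows lmul_star: "lmul (star m) x = star (rmul m (star x))"
    and rmul_star: "rmul (star m) x = star (lmul m (star x))"
  unfolding star_multiplier_def
  by (subst mk_multiplier; auto intro!: bounded_linear_star_conj
      simp: star_rmul_lmul star_scaleC star_mult lmul_scaleC rmul_scaleC lmul_mult rmul_mult)+

lemmas multiplier_apply = lmul_zero rmul_zero lmul_plus rmul_plus lmul_minus rmul_minus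
  lmul_diff rmul_diff lmul_times rmul_times lmul_scaleR rmul_scaleR lmul_scaleC' rmul_scaleC'
  lmul_star rmul_star

lemma lmul_eqs:
  "lmul (m + n) = lmul m + lmul n" "lmul (m - n) = lmul m - lmul n" "lmul (r *\<^sub>R m) = r *\<^sub>R lmul m"
  "lmul (m * n) = lmul m o\<^sub>L lmul n" "rmul (m - n) = rmul m - rmul n"
  by (auto intro!: blinfun_eqI simp: multiplier_apply blinfun.bilinear_simps)

lemma norm_lmul_le: "norm (lmul m x) \<le> norm m * norm x"
  unfolding norm_multiplier_def by (rule norm_blinfun)

lemma norm_star_le: "norm (star m) \<le> norm m" for m :: "'a multiplier"
  unfolding norm_multiplier_def
proof (rule norm_blinfun_bound)
  show "norm (lmul (star m) x) \<le> norm (lmul m) * norm x" for x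
    using norm_blinfun[of "rmul m" "star x"] by (simp add: lmul_star norm_rmul)
qed simp

lemma norm_mult_le: "norm (m * n) \<le> norm m * norm n" for m n :: "'a multiplier"
  unfolding norm_multiplier_def lmul_eqs by (rule norm_blinfun_compose)

lemma cstar_identity_multiplier: "norm (star m * m) = (norm m)\<^sup>2" for m :: "'a multiplier"
proof (rule antisym)
  have "norm (star m * m) \<le> norm (star m) * norm m" by (rule norm_mult_le)
  also have "\<dots> \<le> norm m * norm m"
    by (intro mult_right_mono norm_star_le) (simp add: norm_multiplier_def)
  finally show "norm (star m * m) \<le> (norm m)\<^sup>2" by (simp add: power2_eq_square)
next
  have nonneg: "0 \<le> norm (star m * m)" by (simp add: norm_multiplier_def)
  have "norm (lmul m) \<le> sqrt (norm (star m * m))"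
  proof (rule norm_blinfun_bound)
    fix x
    have "(norm (lmul m x))\<^sup>2 = norm (star (lmul m x) * lmul m x)" by (simp add: cstar_identity)
    also have "star (lmul m x) * lmul m x = star x * lmul (star m * m) x"
      using star_rmul_lmul[of m "star x" "lmul m x"] by (simp add: multiplier_apply)
    also have "norm \<dots> \<le> norm (star x) * norm (lmul (star m * m) x)" by (rule norm_mult_ineq)
    also have "\<dots> \<le> norm x * (norm (star m * m) * norm x)"
      by (simp add: mult_left_mono norm_lmul_le)
    also have "\<dots> = (sqrt (norm (star m * m)) * norm x)\<^sup>2"
      using nonneg by (simp add: power_mult_distrib power2_eq_square)
    finally show "norm (lmul m x) \<le> sqrt (norm (star m * m)) * norm x"
      by (rule power2_le_imp_le) (simp add: nonneg)
  qed (simp add: nonneg)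
  then have "(norm m)\<^sup>2 \<le> (sqrt (norm (star m * m)))\<^sup>2"
    unfolding norm_multiplier_def[of m] by (intro power_mono) auto
  then show "(norm m)\<^sup>2 \<le> norm (star m * m)" using nonneg by simp
qed

instance
proof
  fix m n p :: "'a multiplier" and r s :: real
  show "m + n + p = m + (n + p)" "m + n = n + m" "0 + m = m" "- m + m = 0" "m - n = m + - n"
    by (auto intro!: multiplier_eqI simp: multiplier_apply)
  show "r *\<^sub>R (m + n) = r *\<^sub>R m + r *\<^sub>R n" "(r + s) *\<^sub>R m = r *\<^sub>R m + s *\<^sub>R m"
    "r *\<^sub>R s *\<^sub>R m = (r * s) *\<^sub>R m" "1 *\<^sub>R m = m"
    by (auto intro!: multiplier_eqI simp: multiplier_apply algebra_simps)
  show "m * n * p = m * (n * p)" "(m + n) * p = m * p + n * p" "m * (n + p) = m * n + m * p"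
    "r *\<^sub>R m * n = r *\<^sub>R (m * n)" "m * r *\<^sub>R n = r *\<^sub>R (m * n)"
    by (auto intro!: multiplier_eqI simp: multiplier_apply blinfun.bilinear_simps)
  show "dist m n = norm (m - n)" by (rule dist_multiplier_def)
  show "sgn m = inverse (norm m) *\<^sub>R m" by (simp add: sgn_multiplier_def)
  show "uniformity = (INF e\<in>{0<..}. principal {(m, n :: 'a multiplier). dist m n < e})"
    by (rule uniformity_multiplier_def)
  show "open U = (\<forall>m\<in>U. \<forall>\<^sub>F (m', n) in uniformity. m' = m \<longrightarrow> n \<in> U)"
    for U :: "'a multiplier set" by (rule open_multiplier_def)
  show "norm m = 0 \<longleftrightarrow> m = 0"
  proof
    assume "norm m = 0"
    then have "lmul m = 0" "rmul m = 0" using norm_rmul[of m] by (simp_all add: norm_multiplier_def)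
    then show "m = 0" by (auto intro!: multiplier_eqI simp: multiplier_apply)
  next
    assume "m = 0"
    then have "lmul m = 0" by (auto intro!: blinfun_eqI simp: multiplier_apply)
    then show "norm m = 0" by (simp add: norm_multiplier_def)
  qed
  show "norm (m + n) \<le> norm m + norm n" "norm (r *\<^sub>R m) = \<bar>r\<bar> * norm m"
    by (simp_all add: norm_multiplier_def lmul_eqs norm_triangle_ineq)
  show "norm (m * n) \<le> norm m * norm n" by (rule norm_mult_le)
qed

end

instance multiplier :: (cstar_algebra) banach
proof
  show "convergent X" if X: "Cauchy X" for X :: "nat \<Rightarrow> 'a multiplier"
  proof -
    have dist_l: "dist (lmul p) (lmul q) = dist p q" and dist_r: "dist (rmul p) (rmul q) = dist p q"
      for p q :: "'a multiplier"
      using norm_rmul[of "p - q"]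
      by (simp_all add: dist_norm dist_multiplier_def norm_multiplier_def lmul_eqs)
    have "Cauchy (\<lambda>k. lmul (X k))" "Cauchy (\<lambda>k. rmul (X k))"
      using X by (simp_all add: Cauchy_def dist_l dist_r)
    then obtain L R where L: "(\<lambda>k. lmul (X k)) \<longlonglongrightarrow> L" and R: "(\<lambda>k. rmul (X k)) \<longlonglongrightarrow> R"
      by (meson Cauchy_convergent_iff convergent_def)
    have Lx: "(\<lambda>k. lmul (X k) x) \<longlonglongrightarrow> L x" and Rx: "(\<lambda>k. rmul (X k) x) \<longlonglongrightarrow> R x" for x
      using L R by (auto intro!: tendsto_intros)
    note cLx = bounded_linear.tendsto[OF bounded_linear_scaleC_right Lx]
    note cRx = bounded_linear.tendsto[OF bounded_linear_scaleC_right Rx]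
    have 1: "L (c *\<^sub>C x) = c *\<^sub>C L x" for c x
      using LIMSEQ_unique[OF Lx] cLx[of c x] by (simp add: lmul_scaleC)
    have 2: "R (c *\<^sub>C x) = c *\<^sub>C R x" for c x
      using LIMSEQ_unique[OF Rx] cRx[of c x] by (simp add: rmul_scaleC)
    have 3: "L (x * y) = L x * y" for x y
      using LIMSEQ_unique[OF Lx] tendsto_mult[OF Lx[of x] tendsto_const[of y]] by (simp add: lmul_mult)
    have 4: "R (x * y) = x * R y" for x y
      using LIMSEQ_unique[OF Rx] tendsto_mult[OF tendsto_const[of x] Rx[of y]] by (simp add: rmul_mult)
    have 5: "R x * y = x * L y" for x y
      using LIMSEQ_unique[OF tendsto_mult[OF Rx[of x] tendsto_const[of y]]]
        tendsto_mult[OF tendsto_const[of x] Lx[of y]] by (simp add: rmul_lmul)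
    note eqs = 1 2 3 4 5
    define M where "M = mk_multiplier L R"
    have M: "lmul M = L"
      using mk_multiplier(1)[OF blinfun.bounded_linear_right blinfun.bounded_linear_right eqs]
      by (simp add: M_def blinfun_apply_inverse)
    have "X \<longlonglongrightarrow> M"
      using L unfolding lim_sequentially M[symmetric] dist_l .
    then show ?thesis by (rule convergentI)
  qed
qed

instance multiplier :: (cstar_algebra) cstar_algebra
proof
  fix m n :: "'a multiplier" and a b :: complex and r :: real
  show "a *\<^sub>C (m + n) = a *\<^sub>C m + a *\<^sub>C n" "(a + b) *\<^sub>C m = a *\<^sub>C m + b *\<^sub>C m"
    "a *\<^sub>C b *\<^sub>C m = (a * b) *\<^sub>C m" "r *\<^sub>R m = complex_of_real r *\<^sub>C m"
    by (auto intro!: multiplier_eqI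
        simp: multiplier_apply scaleC_add_right scaleC_add_left scaleC_scaleC scaleR_scaleC)
  show "a *\<^sub>C m * n = a *\<^sub>C (m * n)" "m * a *\<^sub>C n = a *\<^sub>C (m * n)"
    by (auto intro!: multiplier_eqI simp: multiplier_apply lmul_scaleC rmul_scaleC)
  show "norm (a *\<^sub>C m) = cmod a * norm m"
  proof -
    have le: "norm (c *\<^sub>C k) \<le> cmod c * norm k" for c and k :: "'a multiplier"
      unfolding norm_multiplier_def
    proof (rule norm_blinfun_bound)
      show "norm (lmul (c *\<^sub>C k) x) \<le> cmod c * norm (lmul k) * norm x" for x
        using mult_left_mono[OF norm_blinfun[of "lmul k" x], of "cmod c"]
        by (simp add: multiplier_apply norm_scaleC mult.assoc)
    qed simp
    show ?thesis
    proof (cases "a = 0")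
      case True
      have "0 \<le> norm (a *\<^sub>C m)" by (simp add: norm_multiplier_def)
      then show ?thesis using le[of a m] True by simp
    next
      case False
      have "inverse a *\<^sub>C a *\<^sub>C m = m"
        using False by (auto intro!: multiplier_eqI simp: multiplier_apply scaleC_scaleC)
      then have "norm m \<le> norm (a *\<^sub>C m) / cmod a"
        using le[of "inverse a" "a *\<^sub>C m"] by (simp add: norm_inverse divide_inverse mult.commute)
      then show ?thesis using le[of a m] False by (simp add: field_simps)
    qed
  qed
  show "star (m + n) = star m + star n" "star (a *\<^sub>C m) = cnj a *\<^sub>C star m"
    "star (m * n) = star n * star m" "star (star m) = m"
    by (auto intro!: multiplier_eqI simp: multiplier_apply star_add star_scaleC)
  show "norm (star m * m) = (norm m)\<^sup>2" by (rule cstar_identity_multiplier)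
qed

definition embed_multiplier :: "'a::cstar_algebra \<Rightarrow> 'a multiplier"
  where "embed_multiplier c = mk_multiplier (\<lambda>x. c * x) (\<lambda>x. x * c)"

lemma
  shows lmul_embed [simp]: "lmul (embed_multiplier c) x = c * x"
    and rmul_embed [simp]: "rmul (embed_multiplier c) x = x * c"
  unfolding embed_multiplier_def
  by (subst mk_multiplier; auto intro!: bounded_linear_intros
      simp: mult_scaleC_left mult_scaleC_right mult.assoc)+

section \<open>Subalgebras, ideals and positive cones\<close>

definition csubspace :: "'a::cstar_algebra set \<Rightarrow> bool" where
  "csubspace S \<longleftrightarrow> 0 \<in> S \<and> (\<forall>x\<in>S. \<forall>y\<in>S. x + y \<in> S) \<and> (\<forall>c. \<forall>x\<in>S. c *\<^sub>C x \<in> S)"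

definition csubalgebra :: "'a::cstar_algebra set \<Rightarrow> bool" where
  "csubalgebra S \<longleftrightarrow> csubspace S \<and> (\<forall>x\<in>S. \<forall>y\<in>S. x * y \<in> S)"

definition cstar_subalgebra :: "'a::cstar_algebra set \<Rightarrow> bool" where
  "cstar_subalgebra D \<longleftrightarrow> csubalgebra D \<and> star ` D \<subseteq> D \<and> closed D"

definition ideal_in :: "'a::cstar_algebra set \<Rightarrow> 'a set \<Rightarrow> bool" where
  "ideal_in I B \<longleftrightarrow> csubspace I \<and> I \<subseteq> B \<and> (\<forall>b\<in>B. \<forall>x\<in>I. b * x \<in> I \<and> x * b \<in> I)"

definition faithful_ideal_in :: "'a::cstar_algebra set \<Rightarrow> 'a set \<Rightarrow> bool" where
  "faithful_ideal_in I B \<longleftrightarrow> ideal_in I B \<and>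
     (\<forall>b\<in>B - {0}. \<exists>m\<in>I. \<exists>n\<in>I. b * m \<noteq> 0 \<and> n * b \<noteq> 0)"

text \<open>
  The factor \<open>y\<close> is taken in \<open>D\<close> itself, so for a closed star-subalgebra \<open>D\<close> this is
  the positive cone of the C*-algebra \<open>D\<close>.
\<close>

definition pos_cone :: "'a::cstar_algebra set \<Rightarrow> 'a set" where
  "pos_cone D = {star y * y | y. y \<in> D}"

definition self_adjoint_part :: "'a::cstar_algebra set \<Rightarrow> 'a set" where
  "self_adjoint_part A = {a \<in> A. star a = a}"

definition clinear_on :: "'a::cstar_algebra set \<Rightarrow> ('a \<Rightarrow> 'b::cstar_algebra) \<Rightarrow> bool" where
  "clinear_on A f \<longleftrightarrow> (\<forall>x\<in>A. \<forall>y\<in>A. f (x + y) = f x + f y) \<and>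
     (\<forall>c. \<forall>x\<in>A. f (c *\<^sub>C x) = c *\<^sub>C f x)"

section \<open>C*-Segal algebras\<close>

text \<open>
  A C*-Segal algebra is identified with its image in the surrounding C*-algebra: it is a
  subalgebra \<open>A\<close> of \<open>'a\<close> together with its own norm \<open>nA\<close>, whose values outside \<open>A\<close> are
  irrelevant.  The surrounding C*-algebra \<open>D\<close> is a closed star-subalgebra of \<open>'a\<close>; every
  C*-algebra arises in this way with \<open>D = UNIV\<close>.
\<close>

definition banach_algebra_on :: "'a::cstar_algebra set \<Rightarrow> ('a \<Rightarrow> real) \<Rightarrow> bool" where
  "banach_algebra_on A nA \<longleftrightarrow> csubalgebra A \<and>
     (\<forall>x\<in>A. 0 \<le> nA x \<and> (nA x = 0 \<longleftrightarrow> x = 0)) \<and>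
     (\<forall>c. \<forall>x\<in>A. nA (c *\<^sub>C x) = cmod c * nA x) \<and>
     (\<forall>x\<in>A. \<forall>y\<in>A. nA (x + y) \<le> nA x + nA y) \<and>
     (\<forall>x\<in>A. \<forall>y\<in>A. nA (x * y) \<le> nA x * nA y) \<and>
     (\<forall>X :: nat \<Rightarrow> 'a. (\<forall>k. X k \<in> A) \<and>
        (\<forall>e>0. \<exists>N. \<forall>j\<ge>N. \<forall>k\<ge>N. nA (X j - X k) < e) \<longrightarrow>
        (\<exists>x\<in>A. (\<lambda>k. nA (X k - x)) \<longlonglongrightarrow> 0))"

definition cstar_segal_algebra :: "'a::cstar_algebra set \<Rightarrow> 'a set \<Rightarrow> ('a \<Rightarrow> real) \<Rightarrow> bool" where
  "cstar_segal_algebra D A nA \<longleftrightarrow> cstar_subalgebra D \<and> banach_algebra_on A nA \<and>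
     ideal_in A D \<and> D \<subseteq> closure A \<and> (\<exists>K. \<forall>a\<in>A. norm a \<le> K * nA a)"

definition self_adjoint_segal_algebra :: "'a::cstar_algebra set \<Rightarrow> 'a set \<Rightarrow> ('a \<Rightarrow> real) \<Rightarrow> bool"
  where "self_adjoint_segal_algebra D A nA \<longleftrightarrow> cstar_segal_algebra D A nA \<and>
     (\<forall>a\<in>A. star a \<in> A \<and> nA (star a) = nA a)"

definition segal_pos :: "'a::cstar_algebra set \<Rightarrow> 'a set \<Rightarrow> 'a set" where
  "segal_pos D A = A \<inter> pos_cone D"

definition segal_le :: "'a::cstar_algebra set \<Rightarrow> 'a set \<Rightarrow> 'a \<Rightarrow> 'a \<Rightarrow> bool" where
  "segal_le D A x y \<longleftrightarrow> y - x \<in> segal_pos D A"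

text \<open>The surrounding C*-algebra is the whole type \<open>'a\<close>, so that \<open>'a multiplier\<close> is \<open>M(C)\<close>.\<close>

definition weighted_cstar_algebra ::
    "'a::cstar_algebra set \<Rightarrow> ('a \<Rightarrow> real) \<Rightarrow> ('a \<Rightarrow> 'a multiplier) \<Rightarrow> bool" where
  "weighted_cstar_algebra A nA \<pi> \<longleftrightarrow> self_adjoint_segal_algebra UNIV A nA \<and>
     clinear_on A \<pi> \<and>
     (\<forall>c. \<forall>a\<in>A. \<pi> (c * a) = embed_multiplier c * \<pi> a \<and> \<pi> (a * c) = \<pi> a * embed_multiplier c) \<and>
     (\<forall>a\<in>A. norm (\<pi> a) = nA a) \<and>
     \<pi> ` segal_pos UNIV A \<subseteq> pos_cone UNIV"

definition order_unit_in :: "'a::cstar_algebra set \<Rightarrow> 'a set \<Rightarrow> 'a \<Rightarrow> bool" where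
  "order_unit_in D B w \<longleftrightarrow> w \<in> segal_pos D B \<and>
     (\<forall>x\<in>self_adjoint_part B. \<exists>l>0. segal_le D B x (l *\<^sub>R w))"

definition order_unit_segal_algebra ::
    "'a::cstar_algebra set \<Rightarrow> 'a set \<Rightarrow> ('a \<Rightarrow> real) \<Rightarrow> 'a \<Rightarrow> bool" where
  "order_unit_segal_algebra D B nB w \<longleftrightarrow> self_adjoint_segal_algebra D B nB \<and>
     order_unit_in D B w \<and>
     (\<forall>b\<in>self_adjoint_part B.
        nB b = Inf {l. 0 < l \<and> segal_le D B (- (l *\<^sub>R w)) b \<and> segal_le D B b (l *\<^sub>R w)})"

text \<open>
  \<open>(B, \<phi>)\<close>, where \<open>B\<close> sits in \<open>E\<close> and has norm \<open>nB\<close> and order unit \<open>w\<close>, is an order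
  unitization of the self-adjoint C*-Segal algebra \<open>A\<close> in \<open>D\<close>.
\<close>

definition order_unitization ::
    "'a::cstar_algebra set \<Rightarrow> 'a set \<Rightarrow> ('a \<Rightarrow> real) \<Rightarrow>
     'b::cstar_algebra set \<Rightarrow> 'b set \<Rightarrow> ('b \<Rightarrow> real) \<Rightarrow> 'b \<Rightarrow> ('a \<Rightarrow> 'b) \<Rightarrow> bool" where
  "order_unitization D A nA E B nB w \<phi> \<longleftrightarrow> order_unit_segal_algebra E B nB w \<and>
     \<phi> ` A \<subseteq> B \<and> clinear_on A \<phi> \<and> (\<forall>x\<in>A. \<forall>y\<in>A. \<phi> (x * y) = \<phi> x * \<phi> y) \<and>
     (\<forall>x\<in>A. nB (\<phi> x) = nA x) \<and>
     \<phi> ` segal_pos D A \<subseteq> segal_pos E B \<and>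
     faithful_ideal_in (\<phi> ` A) B"

end

theory Submission
  imports Defs
begin

text \<open>
  Let \<open>C\<close> be the whole type. The image of \<open>\<pi>\<close> contains \<open>C\<close>, so the inverse of \<open>\<pi>\<close>
  restricts to a contractive bimodule map \<open>W : C \<rightarrow> A\<close>. It is multiplication by a central,
  injective, positive multiplier \<open>w\<close> with \<open>w * \<pi> a = a\<close>. The order unitization is
  \<open>B = w M(C)\<close> with norm \<open>w m \<mapsto> norm m\<close> and order unit \<open>w\<close>, inside its closure \<open>E\<close>:
  since \<open>w m\<close> is positive iff \<open>m\<close> is, \<open>- l w \<le> w m \<le> l w\<close> means \<open>- l \<le> m \<le> l\<close>,
  that is \<open>norm m \<le> l\<close>. Positivity in unital C*-algebras is treated without spectral theory,
  through square roots obtained by iteration and the criterion \<open>norm (t - h) \<le> t\<close>.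
\<close>

section \<open>Square roots\<close>

text \<open>The map \<open>\<pi>\<close> acts as division by \<open>w\<close>: since
  \<open>w * \<pi> a = a\<close>, the copy of \<open>A\<close> consists of products
  \<open>w * m\<close> with \<open>m\<close> in the range of \<open>\<pi>\<close>, and
  \<open>nA\<close> is the norm of \<open>m\<close>. Allowing every multiplier \<open>m\<close>
  adjoins \<open>w\<close> itself, the case \<open>m = 1\<close>. The obstacle is that no hypothesis
  relates the range of \<open>\<pi>\<close> to \<open>C\<close>; that it contains \<open>C\<close>
  comes from the bimodule property, the closedness of the range, and the estimate of the norm of
  \<open>C\<close> by \<open>nA\<close>. Positivity causes trouble twice. The hypothesis speaks only
  of \<open>\<pi> (star c * c)\<close> with \<open>star c * c\<close> in \<open>A\<close>, so
  positivity of \<open>w\<close> needs suitable test elements. And \<open>B\<close> has to be dense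
  in its surrounding algebra, which in general excludes \<open>M(C)\<close> and leads to
  \<open>E\<close>; but a positive element of \<open>E\<close> needs a factor in \<open>E\<close>,
  so the square root of \<open>w\<close> has to be placed there.\<close>

text \<open>Iteration towards \<open>1 - sqrt (1 - x)\<close>. All coefficients of the iterates, as polynomials
  in \<open>x\<close>, are nonnegative, so for \<open>norm x \<le> 1\<close> the scalar case \<open>x = 1\<close> dominates; no unit is needed.\<close>

primrec sqrt_iter :: "'a::real_normed_algebra \<Rightarrow> nat \<Rightarrow> 'a" where
  "sqrt_iter x 0 = 0"
| "sqrt_iter x (Suc n) = (1/2) *\<^sub>R (x + sqrt_iter x n * sqrt_iter x n)"

definition sqrt_lim :: "'a::{real_normed_algebra, banach} \<Rightarrow> 'a" where
  "sqrt_lim x = lim (sqrt_iter x)"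

lemma sqrt_iter_one_bounds: "0 \<le> sqrt_iter (1::real) n" "sqrt_iter (1::real) n \<le> 1"
proof -
  have "0 \<le> sqrt_iter (1::real) n \<and> sqrt_iter (1::real) n \<le> 1"
    by (induction n) (auto simp: mult_le_one)
  then show "0 \<le> sqrt_iter (1::real) n" "sqrt_iter (1::real) n \<le> 1" by auto
qed

lemma sqrt_iter_one_mono: "sqrt_iter (1::real) n \<le> sqrt_iter 1 (Suc n)"
  using zero_le_power2[of "sqrt_iter (1::real) n - 1"]
  by (simp add: power2_eq_square algebra_simps)

lemma sqrt_iter_one_tendsto: "sqrt_iter (1::real) \<longlonglongrightarrow> 1"
proof -
  have "incseq (sqrt_iter (1::real))" by (rule incseq_SucI) (rule sqrt_iter_one_mono)
  then obtain Q where Q: "sqrt_iter (1::real) \<longlonglongrightarrow> Q"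
    using incseq_convergent[of "sqrt_iter (1::real)" 1] sqrt_iter_one_bounds(2) by blast
  have "(\<lambda>n. sqrt_iter (1::real) (Suc n)) \<longlonglongrightarrow> (1/2) *\<^sub>R (1 + Q * Q)"
    unfolding sqrt_iter.simps by (intro tendsto_intros Q)
  then have "Q = (1/2) *\<^sub>R (1 + Q * Q)"
    using LIMSEQ_Suc[OF Q] LIMSEQ_unique by blast
  then have "(Q - 1)\<^sup>2 = 0" by (simp add: power2_eq_square algebra_simps)
  then show ?thesis using Q by simp
qed

lemma norm_sqrt_iter_le:
  assumes "norm x \<le> 1"
  shows "norm (sqrt_iter x n) \<le> sqrt_iter 1 n"
proof (induction n)
  case (Suc n)
  have "norm (x + sqrt_iter x n * sqrt_iter x n) \<le> norm x + norm (sqrt_iter x n) * norm (sqrt_iter x n)"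
    by (meson add_left_mono norm_mult_ineq norm_triangle_le)
  also have "\<dots> \<le> 1 + sqrt_iter 1 n * sqrt_iter 1 n"
    by (intro add_mono mult_mono Suc assms) (auto simp: sqrt_iter_one_bounds)
  finally show ?case by simp
qed simp

text \<open>In the difference of consecutive iterates, \<open>y * y - z * z\<close> splits as
  \<open>y * (y - z) + (y - z) * z\<close>. The resulting bound in the scalar iterates is exactly
  \<open>p * p - q * q\<close>, so the domination reproduces itself. Telescoping then makes
  convergence of the scalar iterates a Cauchy estimate for \<open>x\<close>.\<close>

lemma norm_sqrt_iter_step:
  assumes "norm x \<le> 1"
  shows "norm (sqrt_iter x (Suc n) - sqrt_iter x n) \<le> sqrt_iter 1 (Suc n) - sqrt_iter 1 n"
proof (induction n)
  case 0
  then show ?case using assms by simp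
next
  case (Suc n)
  define y z where "y = sqrt_iter x (Suc n)" and "z = sqrt_iter x n"
  define p q :: real where "p = sqrt_iter 1 (Suc n)" and "q = sqrt_iter 1 n"
  have IH: "norm (y - z) \<le> p - q" using Suc by (simp only: y_def z_def p_def q_def)
  have y: "norm y \<le> p" and z: "norm z \<le> q"
    unfolding y_def z_def p_def q_def by (rule norm_sqrt_iter_le[OF assms])+
  have pq: "0 \<le> p" "0 \<le> q" unfolding p_def q_def by (rule sqrt_iter_one_bounds)+
  have "sqrt_iter x (Suc (Suc n)) - sqrt_iter x (Suc n) = (1/2) *\<^sub>R (y * (y - z) + (y - z) * z)"
    unfolding sqrt_iter.simps(2)[of x "Suc n"] sqrt_iter.simps(2)[of x n]
      y_def[symmetric] unfolding z_def[symmetric] by (simp add: algebra_simps y_def z_def)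
  also have "norm \<dots> \<le> (1/2) * (norm y * norm (y - z) + norm (y - z) * norm z)"
    by (simp add: norm_mult_ineq norm_triangle_le add_mono)
  also have "\<dots> \<le> (1/2) * (p * (p - q) + (p - q) * q)"
    using IH y z pq norm_ge_zero[of "y - z"]
    by (intro mult_left_mono add_mono mult_mono) (linarith | simp)+
  also have "\<dots> = sqrt_iter 1 (Suc (Suc n)) - sqrt_iter 1 (Suc n)"
    unfolding p_def q_def by (simp add: algebra_simps)
  finally show ?case .
qed

lemma norm_sqrt_iter_diff:
  assumes "norm x \<le> 1"
  shows "norm (sqrt_iter x (n + k) - sqrt_iter x n) \<le> sqrt_iter 1 (n + k) - sqrt_iter 1 n"
proof (induction k)
  case (Suc k)
  have "norm (sqrt_iter x (n + Suc k) - sqrt_iter x n)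
    \<le> norm (sqrt_iter x (Suc (n + k)) - sqrt_iter x (n + k)) + norm (sqrt_iter x (n + k) - sqrt_iter x n)"
    using norm_triangle_ineq[of "sqrt_iter x (Suc (n + k)) - sqrt_iter x (n + k)"
        "sqrt_iter x (n + k) - sqrt_iter x n"] by (simp del: sqrt_iter.simps)
  then show ?case using Suc norm_sqrt_iter_step[OF assms, of "n + k"] by (simp del: sqrt_iter.simps)
qed simp

lemma sqrt_iter_tendsto:
  fixes x :: "'a::{real_normed_algebra, banach}"
  assumes "norm x \<le> 1"
  shows "sqrt_iter x \<longlonglongrightarrow> sqrt_lim x"
proof -
  have "Cauchy (sqrt_iter x)"
  proof (rule CauchyI')
    fix e :: real assume "0 < e"
    have "Cauchy (sqrt_iter (1::real))" by (rule LIMSEQ_imp_Cauchy[OF sqrt_iter_one_tendsto])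
    then obtain M where M: "\<And>m n. m \<ge> M \<Longrightarrow> n \<ge> M \<Longrightarrow> norm (sqrt_iter (1::real) m - sqrt_iter 1 n) < e"
      using CauchyD \<open>0 < e\<close> by blast
    have "dist (sqrt_iter x m) (sqrt_iter x n) < e" if "m \<ge> M" "n > m" for m n
    proof -
      have "norm (sqrt_iter x (m + (n - m)) - sqrt_iter x m) < e"
        using norm_sqrt_iter_diff[OF assms, of m "n - m"] M[of n m] that by auto
      then show ?thesis using that by (simp add: dist_norm norm_minus_commute)
    qed
    then show "\<exists>M. \<forall>m\<ge>M. \<forall>n>m. dist (sqrt_iter x m) (sqrt_iter x n) < e" by blast
  qed
  then show ?thesis unfolding sqrt_lim_def using Cauchy_convergent convergent_LIMSEQ_iff by blast
qed

lemma sqrt_lim_eq: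
  assumes "norm x \<le> 1"
  shows "2 *\<^sub>R sqrt_lim x = x + sqrt_lim x * sqrt_lim x"
proof -
  note L = sqrt_iter_tendsto[OF assms]
  have "(\<lambda>n. sqrt_iter x (Suc n)) \<longlonglongrightarrow> (1/2) *\<^sub>R (x + sqrt_lim x * sqrt_lim x)"
    unfolding sqrt_iter.simps by (intro tendsto_intros L)
  then have "sqrt_lim x = (1/2) *\<^sub>R (x + sqrt_lim x * sqrt_lim x)"
    using LIMSEQ_Suc[OF L] LIMSEQ_unique by blast
  then have "2 *\<^sub>R sqrt_lim x = 2 *\<^sub>R (1/2) *\<^sub>R (x + sqrt_lim x * sqrt_lim x)" by simp
  then show ?thesis by (simp only: scaleR_scaleR) simp
qed

lemma norm_sqrt_lim_le:
  assumes "norm x \<le> 1"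
  shows "norm (sqrt_lim x) \<le> 1"
proof (rule LIMSEQ_le_const2)
  show "(\<lambda>n. norm (sqrt_iter x n)) \<longlonglongrightarrow> norm (sqrt_lim x)"
    by (intro tendsto_norm sqrt_iter_tendsto assms)
  show "\<exists>N. \<forall>n\<ge>N. norm (sqrt_iter x n) \<le> 1"
    using norm_sqrt_iter_le[OF assms] sqrt_iter_one_bounds(2) order_trans by blast
qed

text \<open>The iterates are polynomials without constant term, so the relation passes from
  \<open>x\<close> and \<open>y\<close> to the iterates and then to the limits. Commutation is the
  case \<open>y = x\<close>; two different arguments occur when products \<open>star y * y\<close>
  are shown to be positive.\<close>

lemma sqrt_lim_intertwine:
  assumes "norm x \<le> 1" "norm y \<le> 1" and zx: "z * x = y * z"
  shows "z * sqrt_lim x = sqrt_lim y * z"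
proof -
  have "z * sqrt_iter x n = sqrt_iter y n * z" for n
  proof (induction n)
    case (Suc n)
    have "z * (sqrt_iter x n * sqrt_iter x n) = sqrt_iter y n * sqrt_iter y n * z"
      by (metis Suc mult.assoc)
    then show ?case by (simp add: distrib_left distrib_right zx)
  qed simp
  moreover have "(\<lambda>n. z * sqrt_iter x n) \<longlonglongrightarrow> z * sqrt_lim x"
    "(\<lambda>n. sqrt_iter y n * z) \<longlonglongrightarrow> sqrt_lim y * z"
    by (intro tendsto_intros sqrt_iter_tendsto assms)+
  ultimately show ?thesis using LIMSEQ_unique by fastforce
qed

lemma star_sqrt_lim:
  fixes x :: "'a::cstar_algebra"
  assumes "norm x \<le> 1" "star x = x"
  shows "star (sqrt_lim x) = sqrt_lim x"
proof -
  have "star (sqrt_iter x n) = sqrt_iter x n" for n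
    by (induction n) (simp_all add: star_scaleR star_add star_mult assms)
  then have "sqrt_iter x \<longlonglongrightarrow> star (sqrt_lim x)"
    using bounded_linear.tendsto[OF bounded_linear_star sqrt_iter_tendsto[OF assms(1)]] by simp
  then show ?thesis by (rule LIMSEQ_unique[OF _ sqrt_iter_tendsto[OF assms(1)]])
qed

section \<open>Positive elements of unital C*-algebras\<close>

class unital_cstar_algebra = cstar_algebra + monoid_mult

lemma star_one [simp]: "star (1 :: 'a::unital_cstar_algebra) = 1"
proof -
  have "(1::'a) = star (star 1 * 1)" by (simp only: mult_1_right star_star)
  also have "\<dots> = star 1 * 1" by (simp only: star_mult star_star)
  finally show ?thesis by simp
qed

lemma norm_one_le: "norm (1 :: 'a::unital_cstar_algebra) \<le> 1"
  using cstar_identity[of "1::'a"] by (cases "norm (1::'a) = 0") (simp_all add: power2_eq_square)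

lemma star_diff: "star (x - y) = star x - star y" for x :: "'a::cstar_algebra"
  using star_add[of x "- y"] by (simp add: star_minus)

lemma scaleC_zero_left [simp]: "0 *\<^sub>C x = 0" for x :: "'a::cstar_algebra"
  using scaleR_scaleC[of 0 x] by simp

lemma scaleC_minus_left [simp]: "(- c) *\<^sub>C x = - (c *\<^sub>C x)" for x :: "'a::cstar_algebra"
  using scaleC_add_left[of c "- c" x] by (simp add: eq_neg_iff_add_eq_0 add.commute)

lemma mult_left_commute_if: "x * y = y * x \<Longrightarrow> x * (y * z) = y * (x * z)" for x :: "'a::semigroup_mult"
  by (simp flip: mult.assoc)

lemma norm_square_self_adjoint: "star s = s \<Longrightarrow> norm (s * s) = norm s ^ 2" for s :: "'a::cstar_algebra"
  using cstar_identity[of s] by simp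

lemma self_adjoint_square_eq_0: "star s = s \<Longrightarrow> s * s = 0 \<Longrightarrow> s = 0" for s :: "'a::cstar_algebra"
  using norm_square_self_adjoint[of s] by simp

lemma self_adjoint_cube_eq_0:
  fixes s :: "'a::cstar_algebra"
  assumes "star s = s" "s * s * s = 0"
  shows "s = 0"
proof -
  have "(s * s) * (s * s) = 0" using assms(2) by (simp add: mult.assoc[symmetric])
  then have "s * s = 0"
    by (rule self_adjoint_square_eq_0[rotated]) (simp add: star_mult assms(1))
  then show ?thesis by (rule self_adjoint_square_eq_0[OF assms(1)])
qed

text \<open>\<open>s + i u\<close> is unitary.\<close>

lemma norm_le_1_if_squares_sum_1:
  fixes s u :: "'a::unital_cstar_algebra"
  assumes s: "star s = s" and u: "star u = u" and com: "s * u = u * s" and sum: "s * s + u * u = 1"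
  shows "norm s \<le> 1"
proof -
  define U where "U = s + \<i> *\<^sub>C u"
  have sU: "star U = s - \<i> *\<^sub>C u" by (simp add: U_def star_add star_scaleC s u)
  have "star U * U = s * s - (\<i> * \<i>) *\<^sub>C (u * u)"
    unfolding sU unfolding U_def
    by (simp add: algebra_simps mult_scaleC_left mult_scaleC_right com scaleC_add_right
        scaleC_diff_right scaleC_scaleC scaleC_minus_right)
  also have "\<dots> = 1" by (simp add: sum)
  finally have "(norm U)\<^sup>2 \<le> 1" using norm_one_le[where 'a = 'a] cstar_identity[of U] by simp
  then have nU: "norm U \<le> 1" using power2_le_imp_le[of "norm U" 1] by simp
  have "U + star U = 2 *\<^sub>R s" unfolding sU unfolding U_def by (simp add: scaleR_2)
  then have "2 * norm s = norm (U + star U)" by (metis norm_scaleR abs_numeral)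
  then show ?thesis using nU norm_triangle_ineq[of U "star U"] by simp
qed

lemma one_minus_sqrt_lim:
  fixes x :: "'a::unital_cstar_algebra"
  assumes "norm x \<le> 1"
  shows "(1 - sqrt_lim x) * (1 - sqrt_lim x) = 1 - x"
  using sqrt_lim_eq[OF assms] by (simp add: algebra_simps scaleR_2)

text \<open>With \<open>u\<close> the square root of \<open>1 - s * s\<close>, the squares of
  \<open>s\<close> and \<open>u\<close> sum to 1. This relation is symmetric, so it bounds
  \<open>u\<close> as well, and \<open>1 - s * s = u * u\<close>.\<close>

lemma norm_one_minus_square:
  fixes s :: "'a::unital_cstar_algebra"
  assumes s: "star s = s" and "norm s \<le> 1"
  shows "norm (1 - s * s) \<le> 1"
proof -
  have n: "norm (s * s) \<le> 1" using assms by (simp add: norm_square_self_adjoint power_le_one)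
  define u where "u = 1 - sqrt_lim (s * s)"
  have uu: "u * u = 1 - s * s" unfolding u_def by (rule one_minus_sqrt_lim[OF n])
  have su: "star u = u" unfolding u_def by (simp add: star_diff star_sqrt_lim n star_mult s)
  have "s * sqrt_lim (s * s) = sqrt_lim (s * s) * s"
    by (rule sqrt_lim_intertwine[OF n n]) (simp add: mult.assoc)
  then have com: "u * s = s * u" unfolding u_def by (simp add: algebra_simps)
  have "norm u \<le> 1" by (rule norm_le_1_if_squares_sum_1[OF su s com]) (simp add: uu)
  then have "norm (u * u) \<le> 1" using su by (simp add: norm_square_self_adjoint power_le_one)
  then show ?thesis by (simp add: uu)
qed

text \<open>Squares of self-adjoint elements instead of products \<open>star y * y\<close>, because
  the iteration produces such squares and the norm criterion is proved for them. Agreement with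
  \<open>pos_cone UNIV\<close> in the unital case is supplied later by
  \<open>positive_star_mult\<close>.\<close>

definition positive :: "'a::cstar_algebra \<Rightarrow> bool" where
  "positive h \<longleftrightarrow> (\<exists>s. star s = s \<and> h = s * s)"

lemma positiveI: "star s = s \<Longrightarrow> positive (s * s)"
  by (auto simp: positive_def)

lemma positive_star: "positive h \<Longrightarrow> star h = h"
  by (auto simp: positive_def star_mult)

lemma positive_zero [simp]: "positive 0"
  using positiveI[of 0] by simp

lemma positive_one [simp]: "positive (1 :: 'a::unital_cstar_algebra)"
  using positiveI[of "1::'a"] by simp

lemma positive_scaleR:
  assumes "positive h" "0 \<le> r"
  shows "positive (r *\<^sub>R h)"
proof -
  obtain s where s: "star s = s" "h = s * s" using assms(1) by (auto simp: positive_def)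
  have "r *\<^sub>R h = (sqrt r * sqrt r) *\<^sub>R (s * s)" using assms(2) s by simp
  also have "\<dots> = (sqrt r *\<^sub>R s) * (sqrt r *\<^sub>R s)"
    by (simp only: mult_scaleR_left mult_scaleR_right scaleR_scaleR)
  finally have "r *\<^sub>R h = (sqrt r *\<^sub>R s) * (sqrt r *\<^sub>R s)" .
  then show ?thesis by (simp only:) (rule positiveI, simp add: star_scaleR s)
qed

lemma positive_norm_diff_le:
  fixes h :: "'a::unital_cstar_algebra"
  assumes "positive h" "norm h \<le> t"
  shows "norm (t *\<^sub>R 1 - h) \<le> t"
proof (cases "t = 0")
  case False
  with assms(2) have t: "t > 0" using norm_ge_zero[of h] by linarith
  have h': "positive ((1/t) *\<^sub>R h)" using assms(1) t by (intro positive_scaleR) auto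
  then obtain s where s: "star s = s" "(1/t) *\<^sub>R h = s * s" by (auto simp: positive_def)
  have "(norm s)\<^sup>2 = norm ((1/t) *\<^sub>R h)" by (simp only: s norm_square_self_adjoint)
  also have "\<dots> = norm h / t" using t by simp
  also have "\<dots> \<le> 1" using assms(2) t by simp
  finally have "norm s \<le> 1" using power2_le_imp_le[of "norm s" 1] by simp
  then have "norm (1 - (1/t) *\<^sub>R h) \<le> 1" using norm_one_minus_square s by metis
  then have "t * norm (1 - (1/t) *\<^sub>R h) \<le> t" using t by simp
  then have "norm (t *\<^sub>R (1 - (1/t) *\<^sub>R h)) \<le> t" using t by simp
  then show ?thesis using t by (simp add: scaleR_diff_right)
qed (use assms in simp)

text \<open>Scaling gives \<open>h = t *\<^sub>R (1 - x)\<close> with \<open>norm x \<le> 1\<close>,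
  and \<open>1 - x\<close> is the square of \<open>1 - sqrt_lim x\<close>.\<close>

lemma positive_if_norm_diff_le:
  fixes h :: "'a::unital_cstar_algebra"
  assumes h: "star h = h" and n: "norm (t *\<^sub>R 1 - h) \<le> t"
  shows "positive h"
proof (cases "t = 0")
  case False
  with n have t: "t > 0" using norm_ge_zero[of "t *\<^sub>R 1 - h"] by linarith
  define x where "x = 1 - (1/t) *\<^sub>R h"
  have "t *\<^sub>R 1 - h = t *\<^sub>R x" using t by (simp add: x_def scaleR_diff_right)
  then have x: "norm x \<le> 1" using n t by simp
  have sx: "star x = x" by (simp add: x_def star_diff star_scaleR h)
  have "positive (1 - x)"
    unfolding one_minus_sqrt_lim[OF x, symmetric]
    by (rule positiveI) (simp add: star_diff star_sqrt_lim x sx)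
  then have "positive (t *\<^sub>R (1 - x))" using t by (intro positive_scaleR) auto
  then show ?thesis using t by (simp add: x_def)
qed (use n in simp)

text \<open>The norm criterion reduces a statement about squares to the triangle inequality, with
  the two radii adding up.\<close>

lemma positive_add:
  fixes h k :: "'a::unital_cstar_algebra"
  assumes "positive h" "positive k"
  shows "positive (h + k)"
proof (rule positive_if_norm_diff_le)
  show "star (h + k) = h + k" using assms by (simp add: star_add positive_star)
  have "norm ((norm h *\<^sub>R 1 - h) + (norm k *\<^sub>R 1 - k)) \<le> norm h + norm k"
    by (intro norm_triangle_le add_mono positive_norm_diff_le assms order_refl)
  then show "norm ((norm h + norm k) *\<^sub>R 1 - (h + k)) \<le> norm h + norm k"
    by (simp add: algebra_simps)
qed

text \<open>Division by \<open>norm h\<close> makes the argument of \<open>sqrt_lim\<close> a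
  contraction. For \<open>h = 0\<close> that argument is 1, and the factor
  \<open>sqrt (norm h)\<close> makes the value 0.\<close>

definition positive_sqrt :: "'a::unital_cstar_algebra \<Rightarrow> 'a" where
  "positive_sqrt h = sqrt (norm h) *\<^sub>R (1 - sqrt_lim (1 - (1 / norm h) *\<^sub>R h))"

lemma norm_one_minus_scaled_le:
  fixes h :: "'a::unital_cstar_algebra"
  assumes "positive h"
  shows "norm (1 - (1 / norm h) *\<^sub>R h) \<le> 1"
proof (cases "h = 0")
  case False
  have "norm h *\<^sub>R 1 - h = norm h *\<^sub>R (1 - (1 / norm h) *\<^sub>R h)"
    using False by (simp add: scaleR_diff_right)
  then have "norm h * norm (1 - (1 / norm h) *\<^sub>R h) \<le> norm h"
    using positive_norm_diff_le[OF assms order_refl] by (simp only: norm_scaleR abs_norm_cancel)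
  then show ?thesis using False by simp
qed (simp add: norm_one_le)

context
  fixes h :: "'a::unital_cstar_algebra"
  assumes h: "positive h"
begin

lemma positive_sqrt_square: "positive_sqrt h * positive_sqrt h = h"
proof -
  have "positive_sqrt h * positive_sqrt h = norm h *\<^sub>R (1 - (1 - (1 / norm h) *\<^sub>R h))"
    unfolding positive_sqrt_def
    using one_minus_sqrt_lim[OF norm_one_minus_scaled_le[OF h]] by simp
  then show ?thesis by simp
qed

lemma star_positive_sqrt: "star (positive_sqrt h) = positive_sqrt h"
  unfolding positive_sqrt_def
  by (simp add: star_scaleR star_diff star_sqrt_lim norm_one_minus_scaled_le h positive_star)

lemma positive_positive_sqrt: "positive (positive_sqrt h)"
proof (rule positive_if_norm_diff_le[where t = "sqrt (norm h)"])
  have "sqrt (norm h) *\<^sub>R 1 - positive_sqrt h = sqrt (norm h) *\<^sub>R sqrt_lim (1 - (1 / norm h) *\<^sub>R h)"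
    by (simp add: positive_sqrt_def scaleR_diff_right)
  then show "norm (sqrt (norm h) *\<^sub>R 1 - positive_sqrt h) \<le> sqrt (norm h)"
    using norm_sqrt_lim_le[OF norm_one_minus_scaled_le[OF h]] by (simp add: mult_left_le)
qed (rule star_positive_sqrt)

lemma positive_sqrt_intertwine:
  assumes k: "positive k" and "norm h = norm k" and "z * h = k * z"
  shows "z * positive_sqrt h = positive_sqrt k * z"
proof -
  have "z * sqrt_lim (1 - (1 / norm h) *\<^sub>R h) = sqrt_lim (1 - (1 / norm k) *\<^sub>R k) * z"
    using assms by (intro sqrt_lim_intertwine norm_one_minus_scaled_le h) (simp_all add: algebra_simps)
  then show ?thesis unfolding positive_sqrt_def by (simp add: algebra_simps assms(2))
qed

lemma positive_sqrt_commute: "z * h = h * z \<Longrightarrow> z * positive_sqrt h = positive_sqrt h * z"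
  by (rule positive_sqrt_intertwine) (simp_all add: h)

end

lemma positive_mult:
  fixes h k :: "'a::unital_cstar_algebra"
  assumes h: "positive h" and k: "positive k" and com: "h * k = k * h"
  shows "positive (h * k)"
proof -
  define s r where "s = positive_sqrt h" and "r = positive_sqrt k"
  have "k * s = s * k" unfolding s_def by (rule positive_sqrt_commute[OF h]) (simp add: com)
  then have sr: "s * r = r * s" unfolding r_def by (intro positive_sqrt_commute[OF k]) simp
  have "h * k = (s * s) * (r * r)" by (simp add: s_def r_def positive_sqrt_square h k)
  also have "\<dots> = (s * r) * (s * r)"
    by (simp add: mult.assoc sr mult_left_commute_if[OF sr])
  finally have "h * k = (s * r) * (s * r)" .
  moreover have "star (s * r) = s * r"
    unfolding star_mult using sr by (simp add: s_def r_def star_positive_sqrt h k)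
  ultimately show ?thesis by (simp add: positiveI)
qed

text \<open>The product \<open>(1 - x) * (1 + x)\<close> of commuting positive elements is positive,
  and its root is the partner whose square adds up to 1 with \<open>x * x\<close>.\<close>

lemma norm_le_1_if_between:
  fixes x :: "'a::unital_cstar_algebra"
  assumes x: "star x = x" and "positive (1 - x)" "positive (1 + x)"
  shows "norm x \<le> 1"
proof -
  have "(1 - x) * (1 + x) = (1 + x) * (1 - x)" by (simp add: algebra_simps)
  then have p: "positive ((1 - x) * (1 + x))" by (rule positive_mult[OF assms(2,3)])
  show ?thesis
  proof (rule norm_le_1_if_squares_sum_1[OF x star_positive_sqrt[OF p]])
    show "x * positive_sqrt ((1 - x) * (1 + x)) = positive_sqrt ((1 - x) * (1 + x)) * x"
      by (rule positive_sqrt_commute[OF p]) (simp add: algebra_simps)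
    show "x * x + positive_sqrt ((1 - x) * (1 + x)) * positive_sqrt ((1 - x) * (1 + x)) = 1"
      unfolding positive_sqrt_square[OF p] by (simp add: algebra_simps)
  qed
qed

lemma norm_le_if_between:
  fixes x :: "'a::unital_cstar_algebra"
  assumes x: "star x = x" and l: "l > 0" and "positive (l *\<^sub>R 1 - x)" "positive (l *\<^sub>R 1 + x)"
  shows "norm x \<le> l"
proof -
  have "positive ((1/l) *\<^sub>R (l *\<^sub>R 1 - x))" "positive ((1/l) *\<^sub>R (l *\<^sub>R 1 + x))"
    using assms by (auto intro!: positive_scaleR)
  then have "norm ((1/l) *\<^sub>R x) \<le> 1"
    using l by (intro norm_le_1_if_between) (simp_all add: star_scaleR x algebra_simps)
  then show ?thesis using l by (simp add: divide_le_eq)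
qed

text \<open>Every multiple of \<open>h\<close> by a natural number stays between -1 and 1, so the
  Archimedean property leaves only 0.\<close>

lemma positive_antisym:
  fixes h :: "'a::unital_cstar_algebra"
  assumes "positive h" "positive (- h)"
  shows "h = 0"
proof -
  have "norm (real n *\<^sub>R h) \<le> 1" for n
  proof (rule norm_le_1_if_between)
    show "star (real n *\<^sub>R h) = real n *\<^sub>R h" by (simp add: star_scaleR positive_star assms)
    show "positive (1 + real n *\<^sub>R h)" using assms by (intro positive_add positive_scaleR) auto
    have "positive (1 + real n *\<^sub>R (- h))" using assms by (intro positive_add positive_scaleR) auto
    then show "positive (1 - real n *\<^sub>R h)" by simp
  qed
  then have le: "real n * norm h \<le> 1" for n by simp
  show ?thesis
  proof (rule ccontr)
    assume "h \<noteq> 0"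
    then obtain n where "1 < real n * norm h" using reals_Archimedean3[of "norm h"] by auto
    with le[of n] show False by simp
  qed
qed

lemma positive_add_eq_0:
  fixes h k :: "'a::unital_cstar_algebra"
  assumes "positive h" "positive k" "h + k = 0"
  shows "h = 0"
proof -
  have "k = - h" using assms(3) by (simp add: eq_neg_iff_add_eq_0 add.commute)
  then show ?thesis using positive_antisym[OF assms(1)] assms(2) by simp
qed

text \<open>For \<open>d = s - k\<close>, commutation gives \<open>d * (s + k) = 0\<close>. Hence
  \<open>d * d * s\<close> and \<open>d * d * k\<close> are positive with sum 0, so both vanish, and
  so does their difference, the cube of \<open>d\<close>.\<close>

lemma positive_sqrt_unique:
  fixes k :: "'a::unital_cstar_algebra"
  assumes k: "positive k"
  shows "positive_sqrt (k * k) = k"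
proof -
  define s d where "s = positive_sqrt (k * k)" and "d = s - k"
  have kk: "positive (k * k)" by (rule positiveI[OF positive_star[OF k]])
  have s: "positive s" "s * s = k * k"
    unfolding s_def by (simp_all add: positive_positive_sqrt positive_sqrt_square kk)
  have ks: "k * s = s * k" unfolding s_def by (rule positive_sqrt_commute[OF kk]) (simp add: mult.assoc)
  have sd: "star d = d" unfolding d_def by (simp add: star_diff positive_star s k)
  have dd: "positive (d * d)" by (rule positiveI[OF sd])
  have com: "d * s = s * d" "d * k = k * d" unfolding d_def by (simp_all add: algebra_simps ks)
  have "d * (s + k) = 0" unfolding d_def by (simp add: algebra_simps ks s)
  then have z: "(d * d) * s + (d * d) * k = 0" by (simp add: mult.assoc flip: distrib_left)
  have 1: "positive ((d * d) * s)" by (rule positive_mult[OF dd s(1)])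
      (simp add: mult.assoc com(1)[symmetric] mult_left_commute_if[OF com(1)[symmetric]])
  have 2: "positive ((d * d) * k)"
    by (rule positive_mult[OF dd k])
      (simp add: mult.assoc com(2)[symmetric] mult_left_commute_if[OF com(2)[symmetric]])
  have "(d * d) * s = 0" by (rule positive_add_eq_0[OF 1 2 z])
  then have "d * d * d = 0" using z by (simp add: d_def right_diff_distrib)
  then have "d = 0" by (rule self_adjoint_cube_eq_0[OF sd])
  then show ?thesis by (simp add: d_def s_def)
qed

text \<open>Applied to \<open>b = |x| - x\<close> and \<open>a = |x|\<close>. The proof shows \<open>b = |b|\<close>.\<close>

lemma positive_if_square_eq:
  fixes a b :: "'a::unital_cstar_algebra"
  assumes a: "positive a" and b: "star b = b" and ab: "a * b = b * a" and bb: "b * b = 2 *\<^sub>R (a * b)"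
  shows "positive b"
proof -
  have pbb: "positive (b * b)" by (rule positiveI[OF b])
  define c d where "c = positive_sqrt (b * b)" and "d = c - b"
  have c: "positive c" "c * c = b * b"
    unfolding c_def by (simp_all add: positive_positive_sqrt positive_sqrt_square pbb)
  have bc: "b * c = c * b" unfolding c_def by (rule positive_sqrt_commute[OF pbb]) (simp add: mult.assoc)
  have ac: "a * c = c * a"
    unfolding c_def by (rule positive_sqrt_commute[OF pbb])
      (simp add: mult.assoc ab mult_left_commute_if[OF ab])
  have sd: "star d = d" unfolding d_def by (simp add: star_diff positive_star c b)
  have com: "c * d = d * c" "b * d = d * b" "a * d = d * a"
    unfolding d_def by (simp_all add: algebra_simps bc ab ac)
  have db: "d * b = - (d * c)" unfolding d_def by (simp add: algebra_simps c bc)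
  have dd: "d * d = 2 *\<^sub>R (d * c)" unfolding d_def by (simp add: algebra_simps c bc scaleR_2)
  have dc: "positive (d * d)" by (rule positiveI[OF sd])
  have acp: "positive (a * c)" by (rule positive_mult[OF a c(1) ac])
  \<comment> \<open>Here \<open>c * c = b * b = 2 *\<^sub>R (a * b)\<close>, and replacing
    \<open>d * b\<close> by \<open>- (d * c)\<close> flips the sign. Two positive elements thus sum
    to 0, which kills \<open>d * c\<close> and with it \<open>d\<close>.\<close>
  have "d * d * (c * c) = 2 *\<^sub>R (d * d * (a * b))" by (simp add: c bb)
  also have "d * d * (a * b) = d * a * (d * b)"
    by (simp add: mult.assoc com(3) mult_left_commute_if[OF com(3)])
  also have "\<dots> = - (d * d * (a * c))"
    unfolding db by (simp add: mult.assoc com(3) mult_left_commute_if[OF com(3)])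
  finally have z: "d * d * (c * c) + 2 *\<^sub>R (d * d * (a * c)) = 0" by simp
  have 1: "positive (d * d * (c * c))"
    by (rule positive_mult[OF dc positiveI[OF positive_star[OF c(1)]]])
      (simp add: mult.assoc com(1) mult_left_commute_if[OF com(1)])
  have 2: "positive (d * d * (a * c))"
    by (rule positive_mult[OF dc acp])
      (simp add: mult.assoc com(1,3) mult_left_commute_if[OF com(1)] mult_left_commute_if[OF com(3)])
  have "d * d * (c * c) = 0"
    by (rule positive_add_eq_0[OF 1 positive_scaleR[OF 2] z]) simp
  then have "(d * c) * (d * c) = 0" by (simp add: mult.assoc com(1) mult_left_commute_if[OF com(1)])
  then have "d * c = 0"
    by (rule self_adjoint_square_eq_0[rotated]) (simp add: star_mult sd positive_star c com)
  then have "d = 0" using dd self_adjoint_square_eq_0[OF sd] by simp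
  then show ?thesis using c by (simp add: d_def)
qed

text \<open>The element \<open>n\<close> to be excluded is the negative part of \<open>x\<close>.\<close>

lemma positive_if_no_negative_part:
  fixes x :: "'a::unital_cstar_algebra"
  assumes x: "star x = x"
    and n0: "\<And>n. positive n \<Longrightarrow> n * x = - (n * n) \<Longrightarrow> x * n = - (n * n) \<Longrightarrow> n = 0"
  shows "positive x"
proof -
  have xx: "positive (x * x)" by (rule positiveI[OF x])
  define a where "a = positive_sqrt (x * x)"
  have a: "positive a" "a * a = x * x"
    unfolding a_def by (simp_all add: positive_positive_sqrt positive_sqrt_square xx)
  have xa: "x * a = a * x" unfolding a_def by (rule positive_sqrt_commute[OF xx]) (simp add: mult.assoc)
  have "positive (a - x)"
    by (rule positive_if_square_eq[OF a(1)])
      (simp_all add: star_diff positive_star a x algebra_simps xa scaleR_2)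
  then have "(1/2) *\<^sub>R (a - x) = 0"
    by (intro n0 positive_scaleR) (simp_all add: algebra_simps xa a flip: scaleR_left.add)
  then show ?thesis using a(1) by simp
qed

lemma positive_cube:
  fixes n :: "'a::unital_cstar_algebra"
  assumes "positive n"
  shows "positive (n * n * n)"
  by (intro positive_mult positiveI assms) (simp_all add: positive_star assms mult.assoc)

text \<open>With \<open>z = y n\<close>, \<open>n\<close> the negative part of \<open>star y * y\<close>, the element \<open>k = - star z * z = n^3\<close> and
  \<open>g = z * star z\<close> are both positive. Since \<open>z k = - g z\<close>, taking square roots in \<open>z k^2 = g^2 z\<close>
  yields \<open>z k = g z\<close>, so \<open>z k = 0\<close>.\<close>

theorem positive_star_mult:
  fixes y :: "'a::unital_cstar_algebra"
  shows "positive (star y * y)"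
proof (rule positive_if_no_negative_part)
  show "star (star y * y) = star y * y" by (simp add: star_mult)
next
  fix n :: 'a
  assume n: "positive n" and nx: "n * (star y * y) = - (n * n)"
  define z k g where "z = y * n" and "k = n * n * n" and "g = z * star z"
  have k: "positive k" unfolding k_def by (rule positive_cube[OF n])
  have zz: "star z * z = - k"
  proof -
    have "star z * z = (n * (star y * y)) * n"
      by (simp add: z_def star_mult positive_star[OF n] mult.assoc)
    then show ?thesis by (simp only: nx k_def mult_minus_left)
  qed
  \<comment> \<open>Twice the real part and minus twice the imaginary part of \<open>z\<close>. The
    sum of their squares is twice \<open>star z * z + z * star z\<close>, so \<open>g\<close> is
    half of it plus \<open>k\<close>, hence positive.\<close>
  define p q where "p = z + star z" and "q = \<i> *\<^sub>C (z - star z)"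
  have "cnj \<i> *\<^sub>C (star z - z) = \<i> *\<^sub>C (z - star z)"
    using scaleC_scaleC[of \<i> "-1" "star z - z"] scaleR_scaleC[of "-1" "star z - z"] by simp
  then have pq: "positive (p * p)" "positive (q * q)"
    by (auto intro!: positiveI simp: p_def q_def star_add star_diff star_scaleC add.commute)
  have "q * q = - ((z - star z) * (z - star z))"
    unfolding q_def using scaleR_scaleC[of "-1" "(z - star z) * (z - star z)"]
    by (simp add: mult_scaleC_left mult_scaleC_right scaleC_scaleC)
  then have "p * p + q * q = 2 *\<^sub>R (star z * z + z * star z)"
    by (simp add: p_def algebra_simps scaleR_2)
  then have "g = (1/2) *\<^sub>R (p * p + q * q) + k" by (simp add: g_def zz)
  then have g: "positive g" using pq k by (auto intro!: positive_add positive_scaleR)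
  have zk: "z * k = - (g * z)" using zz by (simp add: g_def mult.assoc)
  have gz: "z * (k * k) = (g * g) * z" 
  proof -
    have "z * (k * k) = - (g * (z * k))" by (simp add: zk mult.assoc flip: mult.assoc[of z])
    then show ?thesis by (simp add: zk mult.assoc)
  qed
  \<comment> \<open>Square roots are normalized by the norm, so intertwining two of them needs equal
    norms.\<close>
  have "norm k = norm g"
    using cstar_identity[of z] cstar_identity'[of z] by (simp add: zz g_def)
  then have "z * positive_sqrt (k * k) = positive_sqrt (g * g) * z"
    using gz by (intro positive_sqrt_intertwine positiveI)
      (simp_all add: positive_star k g norm_square_self_adjoint)
  then have "z * k = g * z" by (simp add: positive_sqrt_unique k g)
  with zk have "z * k = - (z * k)" by simp
  then have "2 *\<^sub>R (z * k) = 0" by (simp add: scaleR_2 eq_neg_iff_add_eq_0)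
  then have "z * k = 0" by simp
  then have "star z * z * k = 0" by (simp add: mult.assoc)
  then have "k = 0" using self_adjoint_square_eq_0[OF positive_star[OF k]] zz by simp
  then show "n = 0" using self_adjoint_cube_eq_0[OF positive_star[OF n]] by (simp add: k_def)
qed

lemma pos_cone_UNIV: "pos_cone (UNIV :: 'a::unital_cstar_algebra set) = Collect positive"
proof -
  have "\<exists>y. h = star y * y" if "positive h" for h :: 'a
    using that unfolding positive_def by metis
  then show ?thesis by (auto simp: pos_cone_def positive_star_mult)
qed

lemma positive_conj:
  fixes h :: "'a::unital_cstar_algebra"
  assumes "positive h"
  shows "positive (star z * h * z)"
proof -
  have "star z * h * z = star z * (positive_sqrt h * positive_sqrt h) * z"
    by (simp add: positive_sqrt_square assms)
  also have "\<dots> = star (positive_sqrt h * z) * (positive_sqrt h * z)"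
    by (simp add: star_mult star_positive_sqrt assms mult.assoc)
  finally show ?thesis by (simp add: positive_star_mult)
qed

lemma star_power: "star (x ^ n) = star x ^ n" for x :: "'a::unital_cstar_algebra"
  by (induction n) (simp_all add: star_mult power_commutes)

lemma positive_power:
  fixes x :: "'a::unital_cstar_algebra"
  assumes "positive x"
  shows "positive (x ^ n)"
  by (induction n) (auto intro!: positive_mult simp: assms power_commutes)

text \<open>Bernoulli's inequality \<open>(1 - h)^n (1 + n h) \<le> 1\<close> gives \<open>n h (1 - h)^n \<le> 1\<close>.\<close>

lemma norm_mult_power_le:
  fixes h :: "'a::unital_cstar_algebra"
  assumes h: "positive h" and h1: "positive (1 - h)"
  shows "real n * norm (h * (1 - h) ^ n) \<le> 1"
proof -
  define g where "g k = (1 - h) ^ k" for k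
  have g: "positive (g k)" for k unfolding g_def by (rule positive_power[OF h1])
  have com: "g k * h = h * g k" for k
    unfolding g_def by (rule power_commuting_commutes) (simp add: algebra_simps)
  have "positive (1 - g n * (1 + real n *\<^sub>R h))"
  proof (induction n)
    case 0
    then show ?case by (simp add: g_def)
  next
    case (Suc k)
    have gS: "g (Suc k) = g k - g k * h" by (simp add: g_def power_commutes[symmetric] algebra_simps)
    have eq: "1 - g (Suc k) * (1 + real (Suc k) *\<^sub>R h)
      = (1 - g k * (1 + real k *\<^sub>R h)) + real (Suc k) *\<^sub>R (g k * (h * h))"
      unfolding gS by (simp add: algebra_simps)
    have "positive (g k * (h * h))"
      by (rule positive_mult[OF g positiveI[OF positive_star[OF h]]])
        (simp add: mult.assoc com mult_left_commute_if[OF com])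
    then show ?case unfolding eq by (intro positive_add Suc positive_scaleR) simp_all
  qed
  then have "positive ((1 - g n * (1 + real n *\<^sub>R h)) + g n)" by (rule positive_add[OF _ g])
  then have 1: "positive (1 - real n *\<^sub>R (h * g n))" by (simp add: algebra_simps com)
  have hg: "positive (h * g n)" by (rule positive_mult[OF h g]) (simp add: com)
  have "norm (real n *\<^sub>R (h * g n)) \<le> 1"
    by (rule norm_le_1_if_between[OF _ 1])
      (simp_all add: star_scaleR positive_star hg positive_add positive_scaleR)
  then show ?thesis by (simp add: g_def)
qed

section \<open>Central order units\<close>

lemma csubspace_closure:
  fixes S :: "'a::cstar_algebra set"
  assumes "csubspace S"
  shows "csubspace (closure S)"
  unfolding csubspace_def
proof (intro conjI ballI allI)
  show "0 \<in> closure S" using assms closure_subset by (auto simp: csubspace_def)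
  fix x y assume "x \<in> closure S" "y \<in> closure S"
  then obtain f g where "\<And>n. f n \<in> S" "\<And>n. g n \<in> S" "f \<longlonglongrightarrow> x" "g \<longlonglongrightarrow> y"
    unfolding closure_sequential by blast
  then show "x + y \<in> closure S"
    unfolding closure_sequential using assms
    by (intro exI[of _ "\<lambda>n. f n + g n"]) (auto intro: tendsto_add simp: csubspace_def)
next
  fix c x assume x: "x \<in> closure S"
  have "(*\<^sub>C) c ` closure S \<subseteq> closure S"
  proof (rule image_closure_subset)
    show "continuous_on (closure S) ((*\<^sub>C) c :: 'a \<Rightarrow> 'a)"
      by (rule linear_continuous_on[OF bounded_linear_scaleC_right])
    show "(*\<^sub>C) c ` S \<subseteq> closure S" using assms closure_subset by (fastforce simp: csubspace_def)
  qed simp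
  then show "c *\<^sub>C x \<in> closure S" using x by blast
qed

lemma csubspace_diff:
  assumes "csubspace S" "x \<in> S" "y \<in> S"
  shows "x - y \<in> S"
proof -
  have "x + (-1) *\<^sub>C y \<in> S" using assms unfolding csubspace_def by blast
  then show ?thesis using scaleR_scaleC[of "-1" y] by simp
qed

lemma csubspace_scaleR: "csubspace S \<Longrightarrow> x \<in> S \<Longrightarrow> r *\<^sub>R x \<in> S"
  by (simp add: scaleR_scaleC csubspace_def)

lemma norm_le_iff_between:
  fixes m :: "'a::unital_cstar_algebra"
  assumes m: "star m = m" and l: "l > 0"
  shows "norm m \<le> l \<longleftrightarrow> positive (l *\<^sub>R 1 - m) \<and> positive (l *\<^sub>R 1 + m)"
proof
  assume "norm m \<le> l"
  then show "positive (l *\<^sub>R 1 - m) \<and> positive (l *\<^sub>R 1 + m)"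
    by (intro conjI positive_if_norm_diff_le[where t = l])
      (simp_all add: star_diff star_add star_scaleR m)
qed (use norm_le_if_between[OF m l] in blast)

text \<open>The properties of the weight on which \<open>B\<close> rests: \<open>injective\<close>
  makes the factor \<open>m\<close> of \<open>w * m\<close> unique, \<open>contractive\<close> makes
  \<open>nB\<close> submultiplicative, and all but the norm bound enter in reading the order of
  \<open>w * m\<close> off \<open>m\<close>.\<close>

locale central_order_unit =
  fixes w :: "'a::unital_cstar_algebra"
  assumes central: "m * w = w * m"
    and injective: "w * m = 0 \<Longrightarrow> m = 0"
    and pos: "positive w"
    and contractive: "norm w \<le> 1"
begin

definition B :: "'a set" where "B = range ((*) w)"

definition E :: "'a set" where "E = closure B"

definition nB :: "'a \<Rightarrow> real" where "nB b = norm (inv ((*) w) b)"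

lemma inj_mult: "inj ((*) w)"
proof (rule injI)
  fix m n assume "w * m = w * n"
  then have "w * (m - n) = 0" by (simp add: right_diff_distrib)
  then have "m - n = 0" by (rule injective)
  then show "m = n" by simp
qed

lemma mult_left_cancel: "w * m = w * n \<longleftrightarrow> m = n"
  by (rule inj_eq[OF inj_mult])

lemma mult_eq_0_iff_right: "w * m = 0 \<longleftrightarrow> m = 0"
  using mult_left_cancel[of m 0] by simp

lemma nB_mult: "nB (w * m) = norm m"
  by (simp add: nB_def inv_f_f[OF inj_mult])

lemma star_w: "star w = w"
  by (rule positive_star[OF pos])

lemma star_mult_w: "star (w * m) = w * star m"
  by (simp add: star_mult star_w central)

lemma mult_in_B [intro]: "w * m \<in> B"
  by (simp add: B_def)

lemma B_cases: assumes "b \<in> B" obtains m where "b = w * m"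
  using assms by (auto simp: B_def)

lemma mult_central: "m * (w * n) = w * (m * n)"
  by (metis central mult.assoc)

lemma csubspace_B: "csubspace B"
  unfolding csubspace_def
proof (intro conjI ballI allI)
  show "0 \<in> B" using mult_in_B[of 0] by simp
  show "x + y \<in> B" if "x \<in> B" "y \<in> B" for x y
    using that by (elim B_cases) (auto simp flip: distrib_left)
  show "c *\<^sub>C x \<in> B" if "x \<in> B" for c x
    using that by (elim B_cases) (auto simp flip: mult_scaleC_right)
qed

lemma B_mult: "b \<in> B \<Longrightarrow> m * b \<in> B" "b \<in> B \<Longrightarrow> b * m \<in> B"
  by (auto elim!: B_cases simp: mult_central mult.assoc)

lemma csubspace_E: "csubspace E"
  unfolding E_def by (rule csubspace_closure[OF csubspace_B])

lemma B_subset_E: "B \<subseteq> E"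
  unfolding E_def by (rule closure_subset)

lemma E_mult:
  assumes "e \<in> E"
  shows "m * e \<in> E" "e * m \<in> E"
proof -
  have "(*) m ` closure B \<subseteq> closure B" "(\<lambda>x. x * m) ` closure B \<subseteq> closure B"
    by (rule image_closure_subset; use closure_subset[of B] B_mult in \<open>auto intro!: continuous_intros\<close>)+
  then show "m * e \<in> E" "e * m \<in> E" using assms unfolding E_def by blast+
qed

lemma star_E: "e \<in> E \<Longrightarrow> star e \<in> E"
proof -
  have "star ` closure B \<subseteq> closure B"
    using closure_subset[of B]
    by (intro image_closure_subset linear_continuous_on bounded_linear_star)
      (auto elim!: B_cases simp: star_mult_w)
  then show "e \<in> E \<Longrightarrow> star e \<in> E" unfolding E_def by blast
qed

text \<open>The square root is a limit of polynomials in \<open>w\<close>; subtracting constants that tend to \<open>0\<close>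
  removes their constant terms.\<close>

lemma positive_sqrt_in_E: "positive_sqrt w \<in> E"
proof -
  define x where "x = 1 - (1 / norm w) *\<^sub>R w"
  have x: "norm x \<le> 1" unfolding x_def by (rule norm_one_minus_scaled_le[OF pos])
  have "sqrt_iter 1 n *\<^sub>R 1 - sqrt_iter x n \<in> B" for n
  proof (induction n)
    case 0
    then show ?case using csubspace_B by (simp add: csubspace_def)
  next
    case (Suc n)
    define y q where "y = sqrt_iter x n" and "q = sqrt_iter (1::real) n"
    have 1: "(1 / norm w) *\<^sub>R w * 1 \<in> B" using csubspace_scaleR[OF csubspace_B mult_in_B[of 1]] by simp
    have 2: "(q *\<^sub>R 1 - y) * (q *\<^sub>R 1 + y) \<in> B"
      using Suc by (intro B_mult) (simp add: y_def q_def)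
    have "sqrt_iter 1 (Suc n) *\<^sub>R 1 - sqrt_iter x (Suc n)
      = (1/2) *\<^sub>R ((1 / norm w) *\<^sub>R w * 1 + (q *\<^sub>R 1 - y) * (q *\<^sub>R 1 + y))"
      unfolding sqrt_iter.simps y_def[symmetric] q_def[symmetric]
      by (simp add: x_def algebra_simps add_divide_distrib)
    also have "\<dots> \<in> B"
      using 1 2 csubspace_B by (intro csubspace_scaleR[OF csubspace_B]) (simp add: csubspace_def)
    finally show ?case .
  qed
  moreover have "(\<lambda>n. sqrt_iter 1 n *\<^sub>R 1 - sqrt_iter x n) \<longlonglongrightarrow> (1::real) *\<^sub>R 1 - sqrt_lim x"
    by (intro tendsto_intros sqrt_iter_one_tendsto sqrt_iter_tendsto x)
  ultimately have "1 *\<^sub>R 1 - sqrt_lim x \<in> E"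
    unfolding E_def closure_sequential
    by (intro exI[of _ "\<lambda>n. sqrt_iter 1 n *\<^sub>R 1 - sqrt_iter x n"] conjI allI)
  then show ?thesis
    unfolding positive_sqrt_def using csubspace_scaleR[OF csubspace_E] by (simp add: x_def)
qed

text \<open>Conjugating \<open>w * x\<close> by the negative part \<open>n\<close> of
  \<open>x\<close> gives \<open>- (w * (n * n * n))\<close>, which is positive together with its
  negative. Thus it vanishes, and injectivity gives \<open>n * n * n = 0\<close>.\<close>

lemma positive_cancel:
  assumes x: "star x = x" and wx: "positive (w * x)"
  shows "positive x"
proof (rule positive_if_no_negative_part[OF x])
  fix n assume n: "positive n" and nx: "n * x = - (n * n)"
  have "star n * (w * x) * n = w * ((n * x) * n)"
    by (simp add: positive_star[OF n] mult_central mult.assoc)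
  also have "\<dots> = - (w * (n * n * n))" by (simp add: nx)
  finally have "star n * (w * x) * n = - (w * (n * n * n))" .
  then have "positive (- (w * (n * n * n)))" using positive_conj[OF wx, of n] by simp
  moreover have "positive (w * (n * n * n))"
    by (intro positive_mult pos positive_cube n) (simp add: central)
  ultimately have "w * (n * n * n) = 0" using positive_antisym by blast
  then have "n * n * n = 0" by (rule injective)
  then show "n = 0" by (rule self_adjoint_cube_eq_0[OF positive_star[OF n]])
qed

text \<open>From left to right the position of the factor in \<open>E\<close> is forgotten.
  Conversely, the factor \<open>positive_sqrt w * positive_sqrt m\<close> lies in \<open>E\<close>,
  because \<open>positive_sqrt w\<close> does and \<open>E\<close> absorbs products.\<close>

lemma segal_pos_iff:
  assumes m: "star m = m"
  shows "w * m \<in> segal_pos E B \<longleftrightarrow> positive m"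
proof
  assume "w * m \<in> segal_pos E B"
  then have "w * m \<in> pos_cone UNIV" by (auto simp: segal_pos_def pos_cone_def)
  then show "positive m" using positive_cancel[OF m] by (simp add: pos_cone_UNIV)
next
  assume pm: "positive m"
  define y where "y = positive_sqrt w * positive_sqrt m"
  have c: "positive_sqrt w * positive_sqrt m = positive_sqrt m * positive_sqrt w"
    by (intro positive_sqrt_commute[OF pm]) (intro positive_sqrt_commute[OF pos, symmetric] central)
  have "star y * y = positive_sqrt w * (positive_sqrt w * (positive_sqrt m * positive_sqrt m))"
    unfolding y_def star_mult star_positive_sqrt[OF pos] star_positive_sqrt[OF pm] c[symmetric]
    by (simp add: mult.assoc c mult_left_commute_if[OF c])
  also have "\<dots> = w * m"
    by (simp add: positive_sqrt_square pos pm flip: mult.assoc[of "positive_sqrt w"])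
  finally have "w * m = star y * y" ..
  moreover have "y \<in> E" unfolding y_def by (intro E_mult positive_sqrt_in_E)
  ultimately have "w * m \<in> pos_cone E" by (auto simp: pos_cone_def)
  then show "w * m \<in> segal_pos E B" by (auto simp: segal_pos_def)
qed

lemma banach_algebra_on_B: "banach_algebra_on B nB"
  unfolding banach_algebra_on_def
proof (intro conjI ballI allI impI)
  show "csubalgebra B" by (simp add: csubalgebra_def csubspace_B B_mult)
  show "nB (c *\<^sub>C x) = cmod c * nB x" if "x \<in> B" for c x
    using that by (elim B_cases) (simp add: nB_mult norm_scaleC flip: mult_scaleC_right)
  show "nB (x + y) \<le> nB x + nB y" if "x \<in> B" "y \<in> B" for x y
    using that by (elim B_cases) (simp add: nB_mult norm_triangle_ineq flip: distrib_left)
  show "nB (x * y) \<le> nB x * nB y" if xy: "x \<in> B" "y \<in> B" for x y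
  proof -
    obtain m n where mn: "x = w * m" "y = w * n" using xy by (elim B_cases)
    have "nB (x * y) = norm (m * (w * n))" by (simp add: mn nB_mult mult.assoc)
    also have "\<dots> \<le> norm m * norm (w * n)" by (rule norm_mult_ineq)
    also have "\<dots> \<le> norm m * norm n"
    proof (intro mult_left_mono)
      have "norm (w * n) \<le> norm w * norm n" by (rule norm_mult_ineq)
      also have "\<dots> \<le> 1 * norm n" by (intro mult_right_mono contractive) simp
      finally show "norm (w * n) \<le> norm n" by simp
    qed simp
    finally show ?thesis by (simp add: mn nB_mult)
  qed
  show "0 \<le> nB x" "(nB x = 0) = (x = 0)" if "x \<in> B" for x
    using that by (elim B_cases; simp add: nB_mult mult_eq_0_iff_right)+
  fix X :: "nat \<Rightarrow> 'a"
  assume X: "(\<forall>k. X k \<in> B) \<and> (\<forall>e>0. \<exists>N. \<forall>j\<ge>N. \<forall>k\<ge>N. nB (X j - X k) < e)"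
  define M where "M k = inv ((*) w) (X k)" for k
  have M: "X k = w * M k" for k
    using X unfolding M_def B_def by (simp add: f_inv_into_f)
  have nB_M: "nB (w * m - w * n) = norm (m - n)" for m n
    by (simp add: nB_mult flip: right_diff_distrib)
  have "Cauchy M" using X by (simp add: M nB_M Cauchy_def dist_norm)
  then obtain L where "M \<longlonglongrightarrow> L" using Cauchy_convergent_iff convergent_def by blast
  then have "(\<lambda>k. nB (X k - w * L)) \<longlonglongrightarrow> 0"
    by (simp add: M nB_M tendsto_norm_zero_iff LIM_zero)
  then show "\<exists>x\<in>B. (\<lambda>k. nB (X k - x)) \<longlonglongrightarrow> 0" by blast
qed

lemma self_adjoint_segal_algebra_B: "self_adjoint_segal_algebra E B nB"
  unfolding self_adjoint_segal_algebra_def cstar_segal_algebra_def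
proof (intro conjI ballI)
  show "cstar_subalgebra E"
    using csubspace_E E_mult star_E by (auto simp: cstar_subalgebra_def csubalgebra_def E_def)
  show "banach_algebra_on B nB" by (rule banach_algebra_on_B)
  show "ideal_in B E" using csubspace_B B_subset_E B_mult by (simp add: ideal_in_def)
  show "E \<subseteq> closure B" by (simp add: E_def)
  show "\<exists>K. \<forall>a\<in>B. norm a \<le> K * nB a"
    by (intro exI[of _ "norm w"]) (auto elim!: B_cases simp: nB_mult norm_mult_ineq)
  show "star a \<in> B" "nB (star a) = nB a" if "a \<in> B" for a
    using that by (auto elim!: B_cases simp: star_mult_w nB_mult)
qed

theorem order_unit_segal_algebra_B: "order_unit_segal_algebra E B nB w"
  unfolding order_unit_segal_algebra_def
proof (intro conjI ballI)
  show "self_adjoint_segal_algebra E B nB" by (rule self_adjoint_segal_algebra_B)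
  have le1: "segal_le E B (w * m) (l *\<^sub>R w) \<longleftrightarrow> positive (l *\<^sub>R 1 - m)"
    and le2: "segal_le E B (- (l *\<^sub>R w)) (w * m) \<longleftrightarrow> positive (l *\<^sub>R 1 + m)"
    if "star m = m" for m l
    using segal_pos_iff[of "l *\<^sub>R 1 - m"] segal_pos_iff[of "l *\<^sub>R 1 + m"] that
    by (simp_all add: segal_le_def star_diff star_add star_scaleR algebra_simps)
  have sa: "\<exists>m. b = w * m \<and> star m = m" if "b \<in> self_adjoint_part B" for b
    using that by (auto simp: self_adjoint_part_def star_mult_w mult_left_cancel elim!: B_cases)
  show "order_unit_in E B w"
    unfolding order_unit_in_def
  proof (intro conjI ballI)
    show "w \<in> segal_pos E B" using segal_pos_iff[of 1] by simp
    fix b assume "b \<in> self_adjoint_part B"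
    then obtain m where m: "b = w * m" "star m = m" using sa by blast
    \<comment> \<open>The summand 1 keeps the bound strictly positive when
      \<open>m = 0\<close>.\<close>
    have "norm m \<le> norm m + 1" "norm m + 1 > 0" by (simp_all add: add_nonneg_pos)
    then show "\<exists>l>0. segal_le E B b (l *\<^sub>R w)"
      using norm_le_iff_between[OF m(2)] m le1 by blast
  qed
  fix b assume "b \<in> self_adjoint_part B"
  then obtain m where m: "b = w * m" "star m = m" using sa by blast
  have "{l. 0 < l \<and> segal_le E B (- (l *\<^sub>R w)) b \<and> segal_le E B b (l *\<^sub>R w)} = {l. 0 < l \<and> norm m \<le> l}"
    using norm_le_iff_between[OF m(2)] by (auto simp: m le1 le2)
  also have "Inf \<dots> = norm m"
  proof (cases "m = 0")
    case True
    then have "{l. 0 < l \<and> norm m \<le> l} = {0<..}" by auto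
    then show ?thesis using True by simp
  next
    case False
    then have "{l. 0 < l \<and> norm m \<le> l} = {norm m..}" by (auto intro: less_le_trans[of 0 "norm m"])
    then show ?thesis by simp
  qed
  finally show "nB b = Inf {l. 0 < l \<and> segal_le E B (- (l *\<^sub>R w)) b \<and> segal_le E B b (l *\<^sub>R w)}"
    by (simp add: m nB_mult)
qed

end

section \<open>Multipliers\<close>

text \<open>The norm sees only the left component, and \<open>norm_rmul\<close> ensures that it
  vanishes only at 0.\<close>

lemma multiplier_eqI_left: "(\<And>x. lmul m x = lmul n x) \<Longrightarrow> m = n"
proof -
  assume "\<And>x. lmul m x = lmul n x"
  then have "lmul (m - n) = 0" by (intro blinfun_eqI) (simp add: multiplier_apply)
  then have "norm (m - n) = 0" by (simp add: norm_multiplier_def)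
  then show "m = n" by simp
qed

lemma multiplier_eqI_right: "(\<And>x. rmul m x = rmul n x) \<Longrightarrow> m = n"
proof -
  assume "\<And>x. rmul m x = rmul n x"
  then have "rmul (m - n) = 0" by (intro blinfun_eqI) (simp add: multiplier_apply)
  then have "norm (m - n) = 0" by (simp add: norm_multiplier_def flip: norm_rmul)
  then show "m = n" by simp
qed

instantiation multiplier :: (cstar_algebra) unital_cstar_algebra
begin

definition "1 = mk_multiplier (\<lambda>x. x) (\<lambda>x. x)"

lemma lmul_one: "lmul 1 x = x" and rmul_one: "rmul 1 x = x"
  unfolding one_multiplier_def by (subst mk_multiplier; auto intro: bounded_linear_ident)+

instance
  by standard (rule multiplier_eqI_left; simp add: multiplier_apply lmul_one)+

end

notation embed_multiplier ("\<iota>")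

lemma embed_add: "\<iota> (x + y) = \<iota> x + \<iota> y"
  and embed_diff: "\<iota> (x - y) = \<iota> x - \<iota> y"
  and embed_scaleC: "\<iota> (c *\<^sub>C x) = c *\<^sub>C \<iota> x"
  and embed_mult: "\<iota> (x * y) = \<iota> x * \<iota> y"
  and embed_star: "\<iota> (star x) = star (\<iota> x)"
  and embed_zero: "\<iota> 0 = 0"
  by (rule multiplier_eqI_left; simp add: multiplier_apply algebra_simps mult_scaleC_left star_mult)+

lemma mult_embed: "m * \<iota> c = \<iota> (lmul m c)"
  by (rule multiplier_eqI_left) (simp add: multiplier_apply lmul_mult)

lemma embed_mult_multiplier: "\<iota> c * m = \<iota> (rmul m c)"
  by (rule multiplier_eqI_left) (simp add: multiplier_apply rmul_lmul)

lemma norm_embed [simp]: "norm (\<iota> c) = norm c"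
proof (rule antisym)
  show "norm (\<iota> c) \<le> norm c"
    unfolding norm_multiplier_def by (rule norm_blinfun_bound) (simp_all add: norm_mult_ineq)
  show "norm c \<le> norm (\<iota> c)"
    using norm_lmul_le[of "\<iota> c" "star c"]
    by (cases "c = 0") (simp_all add: cstar_identity' power2_eq_square)
qed

lemma embed_eq_0_iff: "\<iota> c = 0 \<longleftrightarrow> c = 0"
  using norm_embed[of c] by (metis norm_eq_zero)

lemma bounded_linear_embed: "bounded_linear \<iota>"
  by (rule bounded_linear_intro[where K = 1]) (simp_all add: embed_add scaleR_scaleC embed_scaleC)

section \<open>Weighted C*-algebras\<close>

locale weighted =
  fixes A :: "'c::cstar_algebra set" and nA :: "'c \<Rightarrow> real" and \<pi> :: "'c \<Rightarrow> 'c multiplier"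
  assumes weighted: "weighted_cstar_algebra A nA \<pi>"
begin

lemma
  shows A_mult: "a \<in> A \<Longrightarrow> c * a \<in> A" "a \<in> A \<Longrightarrow> a * c \<in> A"
    and csubspace_A: "csubspace A"
    and star_A: "a \<in> A \<Longrightarrow> star a \<in> A"
    and dense_A: "closure A = UNIV"
    and nA_mult: "a \<in> A \<Longrightarrow> b \<in> A \<Longrightarrow> nA (a * b) \<le> nA a * nA b"
    and complete_A: "\<And>X. (\<And>k. X k \<in> A) \<Longrightarrow> (\<And>e. e > 0 \<Longrightarrow> \<exists>N. \<forall>j\<ge>N. \<forall>k\<ge>N. nA (X j - X k) < e)
      \<Longrightarrow> \<exists>x\<in>A. (\<lambda>k. nA (X k - x)) \<longlonglongrightarrow> 0"
    and norm_le_nA: "\<exists>K. \<forall>a\<in>A. norm a \<le> K * nA a"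
    and pi_add: "a \<in> A \<Longrightarrow> b \<in> A \<Longrightarrow> \<pi> (a + b) = \<pi> a + \<pi> b"
    and pi_scaleC: "a \<in> A \<Longrightarrow> \<pi> (z *\<^sub>C a) = z *\<^sub>C \<pi> a"
    and pi_mult_left: "a \<in> A \<Longrightarrow> \<pi> (c * a) = \<iota> c * \<pi> a"
    and pi_mult_right: "a \<in> A \<Longrightarrow> \<pi> (a * c) = \<pi> a * \<iota> c"
    and norm_pi: "a \<in> A \<Longrightarrow> norm (\<pi> a) = nA a"
  using weighted
  unfolding weighted_cstar_algebra_def self_adjoint_segal_algebra_def cstar_segal_algebra_def
    banach_algebra_on_def ideal_in_def clinear_on_def segal_pos_def
  by (simp_all add: top.extremum_unique)

lemma pi_pos:
  assumes "star c * c \<in> A"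
  shows "positive (\<pi> (star c * c))"
proof -
  have "star c * c \<in> segal_pos UNIV A" using assms by (auto simp: segal_pos_def pos_cone_def)
  then have "\<pi> (star c * c) \<in> pos_cone UNIV"
    using weighted unfolding weighted_cstar_algebra_def by blast
  then show ?thesis by (simp add: pos_cone_UNIV)
qed

lemma zero_A: "0 \<in> A"
  using csubspace_A by (simp add: csubspace_def)

lemma add_A: "a \<in> A \<Longrightarrow> b \<in> A \<Longrightarrow> a + b \<in> A"
  using csubspace_A by (simp add: csubspace_def)

lemma scaleC_A: "a \<in> A \<Longrightarrow> z *\<^sub>C a \<in> A"
  using csubspace_A by (simp add: csubspace_def)

lemma pi_diff: "a \<in> A \<Longrightarrow> b \<in> A \<Longrightarrow> \<pi> (a - b) = \<pi> a - \<pi> b"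
  using pi_add[of "a - b" b] csubspace_diff[OF csubspace_A] by (simp add: eq_diff_eq)

lemma pi_zero: "\<pi> 0 = 0"
  using pi_diff[OF zero_A zero_A] by simp

lemma pi_minus: "a \<in> A \<Longrightarrow> \<pi> (- a) = - \<pi> a"
  using pi_diff[of 0 a] zero_A by (simp add: pi_zero)

lemma pi_scaleR: "a \<in> A \<Longrightarrow> \<pi> (r *\<^sub>R a) = r *\<^sub>R \<pi> a"
  by (simp add: scaleR_scaleC pi_scaleC)

lemma pi_inj: "a \<in> A \<Longrightarrow> b \<in> A \<Longrightarrow> \<pi> a = \<pi> b \<Longrightarrow> a = b"
proof -
  assume ab: "a \<in> A" "b \<in> A" "\<pi> a = \<pi> b"
  obtain K where K: "\<forall>a\<in>A. norm a \<le> K * nA a" using norm_le_nA by blast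
  have "a - b \<in> A" by (rule csubspace_diff[OF csubspace_A ab(1,2)])
  moreover have "nA (a - b) = 0"
    using ab norm_pi[OF calculation] by (simp add: pi_diff)
  ultimately have "norm (a - b) \<le> 0" using K by fastforce
  then show "a = b" by simp
qed

lemma multiplier_eq_0_left: "(\<And>a. a \<in> A \<Longrightarrow> lmul m a = 0) \<Longrightarrow> m = 0"
proof (rule multiplier_eqI_left)
  assume "\<And>a. a \<in> A \<Longrightarrow> lmul m a = 0"
  then have "closure A \<subseteq> {x. lmul m x = 0}"
    by (intro closure_minimal closed_Collect_eq continuous_intros) auto
  then show "lmul m x = lmul 0 x" for x by (auto simp: dense_A multiplier_apply)
qed

lemma multiplier_eq_0_right: "(\<And>a. a \<in> A \<Longrightarrow> rmul m a = 0) \<Longrightarrow> m = 0"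
proof (rule multiplier_eqI_right)
  assume "\<And>a. a \<in> A \<Longrightarrow> rmul m a = 0"
  then have "closure A \<subseteq> {x. rmul m x = 0}"
    by (intro closure_minimal closed_Collect_eq continuous_intros) auto
  then show "rmul m x = rmul 0 x" for x by (auto simp: dense_A multiplier_apply)
qed

text \<open>Positivity only controls \<open>\<pi> (star a * a)\<close>, since \<open>A\<close> need not be spanned by its positive part.
  Polarization extends self-adjointness to \<open>\<pi> (star a * b)\<close>, and density of \<open>A\<close> removes \<open>b\<close>.\<close>

lemma star_pi_star_mult:
  assumes a: "a \<in> A" and b: "b \<in> A"
  shows "star (\<pi> (star a * b)) = \<pi> (star b * a)"
proof -
  define D where "D x y = star (\<pi> (star x * y)) - \<pi> (star y * x)" for x y
  have D0: "D x x = 0" if "x \<in> A" for x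
    using pi_pos[of x] that A_mult by (simp add: D_def positive_star)
  have anti: "D x y + D y x = 0" if "x \<in> A" "y \<in> A" for x y
  proof -
    have "D (x + y) (x + y) = D x x + D x y + (D y x + D y y)"
      by (simp add: D_def star_add algebra_simps pi_add A_mult add_A that)
    then show ?thesis using D0[of x] D0[of y] D0[of "x + y"] that add_A by simp
  qed
  \<comment> \<open>The defect \<open>D\<close> is antisymmetric by additivity. Replacing
    \<open>b\<close> by its multiple by \<open>\<i>\<close> makes it symmetric too, hence
    zero.\<close>
  have "D a (\<i> *\<^sub>C b) = - (\<i> *\<^sub>C D a b)" "D (\<i> *\<^sub>C b) a = \<i> *\<^sub>C D b a"
    using a b by (simp_all add: D_def star_scaleC mult_scaleC_left mult_scaleC_right
        pi_scaleC pi_minus scaleC_A A_mult scaleC_diff_right scaleC_minus_right star_minus)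
  then have "\<i> *\<^sub>C (D b a - D a b) = 0"
    using anti[OF a scaleC_A[OF b], of \<i>] by (simp add: scaleC_diff_right)
  then have "norm (\<i> *\<^sub>C (D b a - D a b)) = 0" by simp
  then have "D b a = D a b" by (simp add: norm_scaleC)
  then have "2 *\<^sub>R D a b = 0" using anti[OF a b] by (simp add: scaleR_2)
  then show ?thesis by (simp add: D_def)
qed

lemma pi_star:
  assumes b: "b \<in> A"
  shows "\<pi> (star b) = star (\<pi> b)"
proof -
  have "lmul (\<pi> (star b) - star (\<pi> b)) a = 0" if a: "a \<in> A" for a
  proof -
    have "star (\<iota> (star a) * \<pi> b) = \<pi> (star b) * \<iota> a"
      using star_pi_star_mult[OF a b]
      unfolding pi_mult_left[OF b, of "star a"] pi_mult_right[OF star_A[OF b], of a] .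
    then have "(\<pi> (star b) - star (\<pi> b)) * \<iota> a = 0"
      by (simp add: star_mult embed_star algebra_simps)
    then show ?thesis by (simp add: mult_embed embed_eq_0_iff)
  qed
  then show ?thesis using multiplier_eq_0_left by fastforce
qed

section \<open>The range of \<open>\<pi>\<close> contains the algebra\<close>

lemma closed_range: "closed {c. \<iota> c \<in> \<pi> ` A}"
  unfolding closed_sequential_limits
proof (intro allI impI)
  fix c l assume cl: "(\<forall>n. c n \<in> {c. \<iota> c \<in> \<pi> ` A}) \<and> c \<longlonglongrightarrow> l"
  then have "\<forall>n. \<exists>a\<in>A. \<pi> a = \<iota> (c n)" by (auto simp: image_iff) metis
  then obtain a where a: "\<And>n. a n \<in> A" "\<And>n. \<pi> (a n) = \<iota> (c n)" by metis
  \<comment> \<open>Both \<open>\<pi>\<close> and \<open>\<iota>\<close> are isometric, so a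
    convergent sequence pulls back to a Cauchy sequence for the complete norm
    \<open>nA\<close>.\<close>
  have "nA (a j - a k) = norm (c j - c k)" for j k
    using norm_pi[OF csubspace_diff[OF csubspace_A a(1) a(1)], of j k]
    by (simp add: pi_diff a flip: embed_diff)
  moreover have "Cauchy c" using cl LIMSEQ_imp_Cauchy by blast
  ultimately obtain x where x: "x \<in> A" "(\<lambda>k. nA (a k - x)) \<longlonglongrightarrow> 0"
    using complete_A[of a] a(1) unfolding Cauchy_def dist_norm by metis
  have "nA (a k - x) = norm (\<iota> (c k) - \<pi> x)" for k
    using norm_pi[OF csubspace_diff[OF csubspace_A a(1) x(1)], of k] by (simp add: pi_diff a x)
  then have "(\<lambda>k. \<iota> (c k)) \<longlonglongrightarrow> \<pi> x"
    using x(2) by (simp add: tendsto_norm_zero_iff LIM_zero_iff)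
  moreover have "(\<lambda>k. \<iota> (c k)) \<longlonglongrightarrow> \<iota> l"
    using cl by (intro bounded_linear.tendsto[OF bounded_linear_embed]) simp
  ultimately have "\<iota> l = \<pi> x" using LIMSEQ_unique by blast
  then show "l \<in> {c. \<iota> c \<in> \<pi> ` A}" using x by blast
qed

text \<open>The element \<open>\<pi> a * m\<close> need not be in the range of \<open>\<pi>\<close>.
  After multiplication by \<open>\<iota> c\<close> it is, as the image of
  \<open>a * lmul m c\<close>, to which the norm estimate on \<open>A\<close> applies.\<close>

lemma norm_embed_mult_le: "\<exists>K\<ge>0. \<forall>a\<in>A. \<forall>m. norm (\<iota> a * m) \<le> K * norm (\<pi> a * m)"
proof -
  obtain K where K: "\<forall>a\<in>A. norm a \<le> K * nA a" using norm_le_nA by blast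
  have K': "norm a \<le> \<bar>K\<bar> * norm (\<pi> a)" if "a \<in> A" for a
    using K that norm_pi[OF that] norm_ge_zero[of "\<pi> a"]
    by (metis abs_ge_self mult_right_mono order_trans)
  have "norm (\<iota> a * m) \<le> \<bar>K\<bar> * norm (\<pi> a * m)" if a: "a \<in> A" for a m
    unfolding norm_multiplier_def[of "\<iota> a * m"]
  proof (rule norm_blinfun_bound)
    fix c
    have "norm (lmul (\<iota> a * m) c) = norm (a * lmul m c)" by (simp add: lmul_times)
    also have "\<dots> \<le> \<bar>K\<bar> * norm (\<pi> (a * lmul m c))" by (intro K' A_mult a)
    also have "\<pi> (a * lmul m c) = \<pi> a * m * \<iota> c"
      using a by (simp add: pi_mult_right mult.assoc mult_embed lmul_times)
    also have "\<bar>K\<bar> * norm (\<pi> a * m * \<iota> c) \<le> \<bar>K\<bar> * (norm (\<pi> a * m) * norm c)"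
      using norm_mult_ineq[of "\<pi> a * m" "\<iota> c"] by (intro mult_left_mono) simp_all
    finally show "norm (lmul (\<iota> a * m) c) \<le> \<bar>K\<bar> * norm (\<pi> a * m) * norm c" by (simp add: mult.assoc)
  qed simp
  then show ?thesis by (intro exI[of _ "\<bar>K\<bar>"]) simp
qed

text \<open>With \<open>h\<close> a multiple of \<open>star (\<pi> a) * \<pi> a\<close>, the elements \<open>a - a (1 - h)^n\<close> lie in the range
  because \<open>d * \<pi> a = \<pi> (d * a)\<close>, and \<open>a (1 - h)^n\<close> is dominated by \<open>\<pi> a (1 - h)^n\<close>, which tends to \<open>0\<close>.\<close>

lemma embed_A_in_range:
  assumes a: "a \<in> A"
  shows "\<iota> a \<in> \<pi> ` A"
proof -
  \<comment> \<open>Large enough to give \<open>norm h \<le> 1\<close>, and nonzero even if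
    \<open>\<pi> a = 0\<close>.\<close>
  define r where "r = norm (\<pi> a) + 1"
  define h where "h = (1 / r\<^sup>2) *\<^sub>R (star (\<pi> a) * \<pi> a)"
  define u where "u n = rmul ((1 - h) ^ n) a" for n
  have r: "r > 0" by (simp add: r_def add_nonneg_pos)
  have h: "positive h" unfolding h_def by (intro positive_scaleR positive_star_mult) simp
  have "norm h = (norm (\<pi> a))\<^sup>2 / r\<^sup>2" by (simp add: h_def cstar_identity)
  also have "\<dots> \<le> 1" using r by (simp add: r_def power_mono)
  finally have "norm h \<le> 1" .
  then have h1: "positive (1 - h)"
    using norm_le_iff_between[of h 1] positive_star[OF h] by simp
  have u: "\<iota> (u n) = \<iota> a * (1 - h) ^ n" for n by (simp add: u_def embed_mult_multiplier)
  have range: "\<iota> (a - u n) \<in> \<pi> ` A" for n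
  proof (induction n)
    case 0
    have "\<iota> (a - u 0) = \<pi> 0" by (simp add: u_def rmul_one embed_zero pi_zero)
    then show ?case using zero_A by blast
  next
    case (Suc n)
    then obtain t where t: "t \<in> A" "\<pi> t = \<iota> a - \<iota> (u n)" by (auto simp: embed_diff)
    \<comment> \<open>The increment between stages is a multiple of
      \<open>\<iota> a * (1 - h) ^ n * star (\<pi> a) * \<pi> a\<close>. The factors before the last
      form an element of \<open>C\<close>, an ideal in its multiplier algebra.\<close>
    define d where "d = rmul ((1 - h) ^ n * star (\<pi> a)) a"
    have "\<iota> a * (1 - h) ^ n * h = (1 / r\<^sup>2) *\<^sub>R (\<iota> d * \<pi> a)"
      by (simp add: h_def d_def mult.assoc flip: embed_mult_multiplier)
    then have "\<iota> (a - u (Suc n)) = \<pi> t + (1 / r\<^sup>2) *\<^sub>R (\<iota> d * \<pi> a)"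
      by (simp only: embed_diff u t power_Suc2 right_diff_distrib mult_1_right flip: mult.assoc) simp
    also have "\<dots> = \<pi> (t + (1 / r\<^sup>2) *\<^sub>R (d * a))"
      using a t csubspace_scaleR[OF csubspace_A] by (simp add: pi_add pi_scaleR pi_mult_left A_mult)
    also have "\<dots> \<in> \<pi> ` A"
      by (intro imageI add_A csubspace_scaleR[OF csubspace_A] A_mult(1) t(1) a)
    finally show ?case .
  qed
  have lim: "(\<lambda>n. a - u n) \<longlonglongrightarrow> a - 0"
  proof (intro tendsto_intros)
    obtain K where K: "K \<ge> 0" "\<forall>a\<in>A. \<forall>m. norm (\<iota> a * m) \<le> K * norm (\<pi> a * m)"
      using norm_embed_mult_le by blast
    have sq: "(norm (u n))\<^sup>2 \<le> (K * r)\<^sup>2 * inverse (real n)" if n: "n > 0" for n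
    proof -
      define e where "e = (1 - h) ^ n"
      have se: "star e = e" by (simp add: e_def star_power positive_star[OF h1])
      have he: "e * h = h * e"
        unfolding e_def by (rule power_commuting_commutes) (simp add: algebra_simps)
      have "norm (u n) \<le> K * norm (\<pi> a * e)" using K(2) a u[of n] by (metis e_def norm_embed)
      then have "(norm (u n))\<^sup>2 \<le> K\<^sup>2 * (norm (\<pi> a * e))\<^sup>2"
        using power_mono[of "norm (u n)" "K * norm (\<pi> a * e)" 2] by (simp add: power_mult_distrib)
      \<comment> \<open>Squaring brings in \<open>star (\<pi> a) * \<pi> a\<close>, a multiple of
        \<open>h\<close>. This factor yields the decay of order 1/n; powers of \<open>1 - h\<close>
        alone need not tend to 0.\<close>
      also have "(norm (\<pi> a * e))\<^sup>2 = norm (e * (star (\<pi> a) * \<pi> a) * e)"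
        by (simp add: star_mult se mult.assoc flip: cstar_identity)
      also have "star (\<pi> a) * \<pi> a = r\<^sup>2 *\<^sub>R h" using r by (simp add: h_def)
      also have "norm (e * (r\<^sup>2 *\<^sub>R h) * e) = r\<^sup>2 * norm (h * (1 - h) ^ (n + n))"
        by (simp add: he mult.assoc power_add flip: e_def)
      also have "norm (h * (1 - h) ^ (n + n)) \<le> inverse (real n)"
      proof -
        have "real n * norm (h * (1 - h) ^ (n + n)) \<le> real (n + n) * norm (h * (1 - h) ^ (n + n))"
          by (intro mult_right_mono) simp_all
        also have "\<dots> \<le> 1" by (rule norm_mult_power_le[OF h h1])
        finally show ?thesis using n by (simp add: field_simps)
      qed
      finally show ?thesis by (simp add: power_mult_distrib mult.assoc mult_left_mono)
    qed
    have bound: "norm ((norm (u n))\<^sup>2) \<le> (K * r)\<^sup>2 * inverse (real n)" if "n > 0" for n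
      using sq[OF that] by (simp only: real_norm_def abs_power2)
    have "(\<lambda>n. (K * r)\<^sup>2 * inverse (real n)) \<longlonglongrightarrow> (K * r)\<^sup>2 * 0"
      by (intro tendsto_intros lim_inverse_n)
    then have lim: "(\<lambda>n. (K * r)\<^sup>2 * inverse (real n)) \<longlonglongrightarrow> 0"
      unfolding mult_zero_right .
    have "(\<lambda>n. (norm (u n))\<^sup>2) \<longlonglongrightarrow> 0"
      by (rule Lim_null_comparison[OF eventually_mono[OF eventually_gt_at_top[of 0] bound] lim])
    then have "(\<lambda>n. sqrt ((norm (u n))\<^sup>2)) \<longlonglongrightarrow> sqrt 0" by (rule tendsto_real_sqrt)
    then show "u \<longlonglongrightarrow> 0" by (simp add: tendsto_norm_zero_iff)
  qed
  have "a - 0 \<in> {c. \<iota> c \<in> \<pi> ` A}"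
    by (rule closed_sequentially[OF closed_range _ lim], rule CollectI, rule range)
  then show ?thesis by (simp only: diff_zero mem_Collect_eq)
qed

lemma embed_in_range: "\<iota> c \<in> \<pi> ` A"
proof -
  have "closure A \<subseteq> {c. \<iota> c \<in> \<pi> ` A}"
    by (rule closure_minimal[OF _ closed_range]) (use embed_A_in_range in blast)
  then show ?thesis using dense_A by auto
qed

section \<open>Multiplication by the weight\<close>

definition W :: "'c \<Rightarrow> 'c" where "W c = inv_into A \<pi> (\<iota> c)"

lemma W_in_A: "W c \<in> A"
  unfolding W_def by (rule inv_into_into[OF embed_in_range])

lemma pi_W: "\<pi> (W c) = \<iota> c"
  unfolding W_def by (rule f_inv_into_f[OF embed_in_range])

lemma W_eqI: "a \<in> A \<Longrightarrow> \<pi> a = \<iota> c \<Longrightarrow> W c = a"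
  by (rule pi_inj[OF W_in_A]) (simp_all add: pi_W)

lemma W_add: "W (x + y) = W x + W y"
  by (rule W_eqI) (simp_all add: add_A W_in_A pi_add pi_W embed_add)

lemma W_scaleC: "W (z *\<^sub>C x) = z *\<^sub>C W x"
  by (rule W_eqI) (simp_all add: scaleC_A W_in_A pi_scaleC pi_W embed_scaleC)

lemma W_mult_left: "W (x * y) = W x * y"
  by (rule W_eqI) (simp_all add: A_mult W_in_A pi_mult_right pi_W embed_mult)

lemma W_mult_right: "W (x * y) = x * W y"
  by (rule W_eqI) (simp_all add: A_mult W_in_A pi_mult_left pi_W embed_mult)

lemma W_star: "W (star x) = star (W x)"
  by (rule W_eqI) (simp_all add: star_A W_in_A pi_star pi_W embed_star)

text \<open>Submultiplicativity of \<open>nA\<close> on \<open>W c * W d\<close>, with \<open>c = star (W d)\<close>.\<close>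

lemma norm_W_le: "norm (W d) \<le> norm d"
proof -
  have "norm (c * W d) \<le> norm c * norm d" for c
  proof -
    have "\<pi> (W c * W d) = \<iota> (c * W d)" by (simp add: pi_mult_right W_in_A pi_W embed_mult)
    then have "norm (c * W d) = nA (W c * W d)"
      using norm_pi[OF A_mult(2)[OF W_in_A]] by (metis norm_embed)
    also have "\<dots> \<le> nA (W c) * nA (W d)" by (intro nA_mult W_in_A)
    also have "\<dots> = norm c * norm d" by (simp add: pi_W flip: norm_pi[OF W_in_A])
    finally show ?thesis .
  qed
  from this[of "star (W d)"] show ?thesis
    by (cases "W d = 0") (simp_all add: cstar_identity power2_eq_square)
qed

definition w :: "'c multiplier" where "w = mk_multiplier W W"

lemma lmul_w: "lmul w x = W x" and rmul_w: "rmul w x = W x"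
proof -
  have "bounded_linear W"
    by (rule bounded_linear_intro[where K = 1])
      (simp_all add: W_add scaleR_scaleC W_scaleC norm_W_le)
  then show "lmul w x = W x" "rmul w x = W x"
    unfolding w_def by (subst mk_multiplier; simp add: W_scaleC W_mult_left flip: W_mult_right)+
qed

text \<open>By the module property \<open>\<pi> a * \<iota> c\<close> is
  \<open>\<pi> (a * c)\<close>, and \<open>W\<close> inverts \<open>\<pi>\<close>. Hence
  \<open>\<iota>\<close> maps \<open>A\<close> into \<open>B\<close>, and
  \<open>nB (\<iota> a)\<close> is the norm of \<open>\<pi> a\<close>.\<close>

lemma w_mult_pi: "a \<in> A \<Longrightarrow> w * \<pi> a = \<iota> a"
  by (rule multiplier_eqI_left)
    (simp add: lmul_times lmul_w W_eqI[OF A_mult(2)] pi_mult_right mult_embed)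

text \<open>Multiplying by \<open>x\<close> on the left moves \<open>m\<close> onto \<open>x\<close>
  as \<open>rmul m x\<close>, and \<open>W\<close> slides through products. So every
  \<open>x\<close> annihilates the difference of the two sides, in particular the adjoint of that
  difference.\<close>

lemma w_central: "m * w = w * m"
proof (rule multiplier_eqI_left)
  fix c
  have "x * (lmul m (W c) - W (lmul m c)) = 0" for x
    by (simp add: right_diff_distrib flip: rmul_lmul W_mult_right)
  then have "(norm (lmul m (W c) - W (lmul m c)))\<^sup>2 = 0"
    using cstar_identity by (metis norm_zero)
  then show "lmul (m * w) c = lmul (w * m) c" by (simp add: lmul_times lmul_w)
qed

lemma w_injective:
  assumes "w * m = 0"
  shows "m = 0"
proof (rule multiplier_eqI_left)
  fix c
  have "W (lmul m c) = 0" using assms by (metis lmul_times lmul_w lmul_zero)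
  then have "\<iota> (lmul m c) = \<pi> 0" by (metis pi_W)
  also have "\<pi> 0 = 0" by (rule pi_zero)
  finally show "lmul m c = lmul 0 c" by (simp add: embed_eq_0_iff lmul_zero)
qed

text \<open>For the negative part \<open>n\<close> of \<open>w\<close>, the test element
  \<open>d = W (lmul n c)\<close> satisfies \<open>\<pi> d = n * \<iota> c\<close> and
  \<open>\<iota> d = - (n * n * \<iota> c)\<close>. Thus the positive element
  \<open>\<pi> (star d * d)\<close> is minus a conjugate of the cube of \<open>n\<close>, so that
  conjugate vanishes for every \<open>c\<close>.\<close>

lemma w_positive: "positive w"
proof (rule positive_if_no_negative_part)
  show "star w = w" by (rule multiplier_eqI_left) (simp add: multiplier_apply lmul_w rmul_w W_star)
  fix n assume n: "positive n" and wn: "w * n = - (n * n)"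
  have n3: "positive (n * n * n)" by (rule positive_cube[OF n])
  define s where "s = positive_sqrt (n * n * n)"
  have s: "star s = s" "s * s = n * n * n"
    unfolding s_def by (simp_all add: star_positive_sqrt positive_sqrt_square n3)
  have "lmul s c = 0" for c
  proof -
    define d where "d = W (lmul n c)"
    have d: "d \<in> A" "\<pi> d = n * \<iota> c" by (simp_all add: d_def W_in_A pi_W mult_embed)
    have "\<iota> d = w * n * \<iota> c" by (simp add: d_def mult_embed lmul_times lmul_w)
    then have id: "\<iota> d = - (n * n * \<iota> c)" by (simp add: wn)
    have "\<pi> (star d * d) = star (\<pi> d) * \<iota> d" by (simp add: pi_mult_right star_A pi_star d(1))
    also have "\<dots> = - (star (\<iota> c) * (n * n * n) * \<iota> c)"
      by (simp add: d(2) id star_mult positive_star[OF n] mult.assoc)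
    finally have "positive (- (star (\<iota> c) * (n * n * n) * \<iota> c))"
      using pi_pos[of d] A_mult d(1) by simp
    moreover have "positive (star (\<iota> c) * (n * n * n) * \<iota> c)" by (rule positive_conj[OF n3])
    ultimately have "star (\<iota> c) * (s * s) * \<iota> c = 0" unfolding s using positive_antisym by blast
    then have "star (s * \<iota> c) * (s * \<iota> c) = 0" by (simp add: star_mult s(1) mult.assoc)
    then have "s * \<iota> c = 0" using cstar_identity[of "s * \<iota> c"] by simp
    then show ?thesis by (simp add: mult_embed embed_eq_0_iff)
  qed
  then have "s = 0" by (intro multiplier_eqI_left) (simp add: lmul_zero)
  then have "n * n * n = 0" using s by simp
  then show "n = 0" by (rule self_adjoint_cube_eq_0[OF positive_star[OF n]])
qed

lemma norm_w_le: "norm w \<le> 1"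
  unfolding norm_multiplier_def by (rule norm_blinfun_bound) (simp_all add: lmul_w norm_W_le)

sublocale central_order_unit w
  by standard (simp_all add: w_central w_injective w_positive norm_w_le)

section \<open>The embedding of \<open>A\<close> into \<open>B\<close>\<close>

lemma embed_in_B: "a \<in> A \<Longrightarrow> \<iota> a \<in> B"
  using w_mult_pi mult_in_B by metis

text \<open>A positive element of \<open>A\<close> is \<open>star y * y\<close> with
  \<open>y\<close> anywhere in \<open>C\<close>, so order preservation needs the image of all of
  \<open>C\<close> in \<open>E\<close>; density of \<open>A\<close> provides it.\<close>

lemma embed_in_E: "\<iota> c \<in> E"
proof -
  have "\<iota> ` closure A \<subseteq> E"
    by (rule image_closure_subset)
      (use embed_in_B B_subset_E in \<open>auto simp: E_def intro: linear_continuous_on bounded_linear_embed\<close>)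
  then show ?thesis by (auto simp: dense_A)
qed

text \<open>Absorption holds because \<open>w\<close> carries the whole image of \<open>C\<close>
  into that of \<open>A\<close>. Faithfulness is density: a multiplier annihilating \<open>A\<close>
  on one side is 0.\<close>

lemma faithful_ideal: "faithful_ideal_in (\<iota> ` A) B"
  unfolding faithful_ideal_in_def ideal_in_def
proof (intro conjI ballI)
  have "0 = \<iota> 0" by (simp add: embed_zero)
  then show "csubspace (\<iota> ` A)"
    using zero_A add_A scaleC_A by (auto simp: csubspace_def simp flip: embed_add embed_scaleC)
  show "\<iota> ` A \<subseteq> B" using embed_in_B by blast
  have wW: "w * \<iota> c \<in> \<iota> ` A" for c using W_in_A by (simp add: mult_embed lmul_w)
  fix b x assume "b \<in> B" and x: "x \<in> \<iota> ` A"
  then obtain m a where b: "b = w * m" and a: "x = \<iota> a" "a \<in> A" by (auto elim: B_cases)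
  have "b * x = w * \<iota> (lmul m a)" by (simp add: b a mult_embed lmul_times)
  then show "b * x \<in> \<iota> ` A" using wW by simp
  have "x * b = w * \<iota> (rmul m a)" by (simp only: b a mult_central[of "\<iota> a"] embed_mult_multiplier[of a m])
  then show "x * b \<in> \<iota> ` A" using wW by simp
next
  fix b assume b: "b \<in> B - {0}"
  obtain m where "m \<in> A" "lmul b m \<noteq> 0" using b multiplier_eq_0_left by blast
  moreover obtain n where "n \<in> A" "rmul b n \<noteq> 0" using b multiplier_eq_0_right by blast
  ultimately show "\<exists>m\<in>\<iota> ` A. \<exists>n\<in>\<iota> ` A. b * m \<noteq> 0 \<and> n * b \<noteq> 0"
    by (auto simp: mult_embed embed_mult_multiplier embed_eq_0_iff)
qed

lemma order_unitization_embed: "order_unitization UNIV A nA E B nB w \<iota>"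
  unfolding order_unitization_def
proof (intro conjI ballI)
  show "order_unit_segal_algebra E B nB w" by (rule order_unit_segal_algebra_B)
  show "\<iota> ` A \<subseteq> B" using embed_in_B by blast
  show "clinear_on A \<iota>" by (simp add: clinear_on_def embed_add embed_scaleC)
  show "\<iota> (x * y) = \<iota> x * \<iota> y" for x y by (rule embed_mult)
  show "nB (\<iota> x) = nA x" if "x \<in> A" for x
    using that nB_mult[of "\<pi> x"] by (simp add: w_mult_pi norm_pi)
  show "\<iota> ` segal_pos UNIV A \<subseteq> segal_pos E B"
    using embed_in_B embed_in_E by (auto simp: segal_pos_def pos_cone_def embed_mult embed_star)
  show "faithful_ideal_in (\<iota> ` A) B" by (rule faithful_ideal)
qed

end

theorem proposition3p23:
  fixes A :: "'c::cstar_algebra set" and nA :: "'c \<Rightarrow> real" and \<pi> :: "'c \<Rightarrow> 'c multiplier"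
  assumes "weighted_cstar_algebra A nA \<pi>"
  shows "\<exists>(E :: 'c multiplier set) B nB w \<phi>. order_unitization UNIV A nA E B nB w \<phi>"
proof -
  interpret weighted A nA \<pi> by standard (rule assms)
  show ?thesis using order_unitization_embed by blast
qed

end
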